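(* Let $\alpha,\beta\ge0$, let $N$ be a positive integer, and let $X$ be a compact subset of a Hilbert space $H$ such that $X-X$ is $(\alpha,\beta)$-almost homogeneous with $d_{\rm A}^{\alpha,\beta}(X-X)<s<N$. If $$\gamma>\frac{2+N(3+\alpha+\beta)+2(\alpha+\beta)}{2(N-s)},$$ then there is a prevalent set $S$ of linear maps $f:H\to\mathbb R^N$ such that every $f\in S$ is injective on $X$ and, in particular, $\gamma$-almost bi-Lipschitz on $X$.
   Context: For $x>0$, $\operatorname{slog}(x):=\log(x+x^{-1})$. For a metric space $(Y,d)$ and $0<\rho<r$, $\mathcal N_Y(r,\rho)$ denotes the minimum number of balls of radius $\rho$ sufficient to cover any ball of radius $r$ in $Y$. For $\alpha,\beta\ge0$, $M\ge1$, $s\ge0$, $Y$ is $(\alpha,\beta)$-almost $(M,s)$-homogeneous if $\mathcal N_Y(r,\rho)\le M\left(\frac r\rho\right)^s\operatorname{slog}(r)^\beta\operatorname{slog}(\rho)^\alpha$ for all $0<\rho<r<\infty$; it is $(\alpha,\beta)$-almost homogeneous if this holds for some $M,s$. The Assouad $(\alpha,\beta)$-dimension $d_{\rm A}^{\alpha,\beta}(Y)$ is the infimum of all $s$ such that $Y$ is $(\alpha,\beta)$-almost $(M,s)$-homogeneous for some $M\ge1$ ($+\infty$ if there is none). For $X\subset H$, $X-X=\{x-y: x,y\in X\}$ with the metric induced by the norm. A map $f$ is $\gamma$-almost bi-Lipschitz on $X$ if there is $L>0$ with $\frac1L\frac{\|x-y\|}{\operatorname{slog}(\|x-y\|)^\gamma}\le|f(x)-f(y)|\le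 L\|x-y\|$ for all $x,y\in X$, $x\ne y$. A Borel subset $S$ of a normed linear space $V$ is prevalent if there exists a compactly supported probability measure $\mu$ on $V$ such that $\mu(S+v)=1$ for all $v\in V$. Here $V$ is the space of bounded linear maps $H\to\mathbb R^N$ with the operator norm. *)

theory Defs
  imports "HOL-Analysis.Analysis" "HOL-Probability.Probability"
begin

definition slog :: "real \<Rightarrow> real" where
  "slog x = ln (x + inverse x)"

(* A subset Y of a metric space is treated as a metric space in its own right: its balls are the
   sets ball y r \<inter> Y with y in Y, so all covering balls have centres in Y as well.  The value is
   \<infinity> (the infimum of the empty set) if no single finite number of balls suffices for every
   ball of radius r. *)
definition covering_number :: "'a::metric_space set \<Rightarrow> real \<Rightarrow> real \<Rightarrow> enat" where
  "covering_number Y r \<rho> =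
     Inf (enat ` {n. \<forall>y\<in>Y. \<exists>C. C \<subseteq> Y \<and> finite C \<and> card C \<le> n \<and>
                        ball y r \<inter> Y \<subseteq> (\<Union>c\<in>C. ball c \<rho> \<inter> Y)})"

definition almost_Ms_homogeneous ::
    "real \<Rightarrow> real \<Rightarrow> real \<Rightarrow> real \<Rightarrow> 'a::metric_space set \<Rightarrow> bool" where
  "almost_Ms_homogeneous \<alpha> \<beta> M s Y \<longleftrightarrow>
     (\<forall>r \<rho>. 0 < \<rho> \<and> \<rho> < r \<longrightarrow>
        ereal_of_enat (covering_number Y r \<rho>)
          \<le> ereal (M * (r / \<rho>) powr s * slog r powr \<beta> * slog \<rho> powr \<alpha>))"

definition almost_homogeneous :: "real \<Rightarrow> real \<Rightarrow> 'a::metric_space set \<Rightarrow> bool" where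
  "almost_homogeneous \<alpha> \<beta> Y \<longleftrightarrow> (\<exists>M s. 1 \<le> M \<and> 0 \<le> s \<and> almost_Ms_homogeneous \<alpha> \<beta> M s Y)"

definition assouad_dim :: "real \<Rightarrow> real \<Rightarrow> 'a::metric_space set \<Rightarrow> ereal" where
  "assouad_dim \<alpha> \<beta> Y =
     Inf (ereal ` {s. 0 \<le> s \<and> (\<exists>M. 1 \<le> M \<and> almost_Ms_homogeneous \<alpha> \<beta> M s Y)})"

definition almost_bi_lipschitz_on ::
    "real \<Rightarrow> 'a::real_normed_vector set \<Rightarrow> ('a \<Rightarrow> 'b::real_normed_vector) \<Rightarrow> bool" where
  "almost_bi_lipschitz_on \<gamma> X f \<longleftrightarrow>
     (\<exists>L>0. \<forall>x\<in>X. \<forall>y\<in>X. x \<noteq> y \<longrightarrow>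
        1 / L * (norm (x - y) / slog (norm (x - y)) powr \<gamma>) \<le> norm (f x - f y) \<and>
        norm (f x - f y) \<le> L * norm (x - y))"

(* Compact support is expressed as: some compact set carries the full mass. *)
definition prevalent :: "'a::real_normed_vector set \<Rightarrow> bool" where
  "prevalent S \<longleftrightarrow> S \<in> sets borel \<and>
     (\<exists>\<mu> :: 'a measure. sets \<mu> = sets borel \<and> prob_space \<mu> \<and>
        (\<exists>K. compact K \<and> emeasure \<mu> K = 1) \<and>
        (\<forall>v. emeasure \<mu> ((\<lambda>x. x + v) ` S) = 1))"

end

theory Submission
  imports Defs "HOL-Real_Asymp.Real_Asymp"
begin

text \<open>
  Let \<open>Z = X - X\<close>, let \<open>N\<close> be the dimension of the target and \<open>a = \<alpha> + \<beta>\<close>. An operator is injective and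
  \<open>\<gamma>\<close>-almost bi-Lipschitz on \<open>X\<close> as soon as \<open>norm (f z)\<close> is at least a constant times
  \<open>norm z / slog (norm z) powr \<gamma>\<close> on \<open>Z - {0}\<close>. On the shell where \<open>norm z\<close> is comparable to \<open>2 powr - j\<close>
  the factor \<open>slog (norm z)\<close> is comparable to \<open>j\<close> (shells being numbered
  from \<open>1\<close> in this paragraph and the next two). What is needed is a random operator \<open>F\<close> with compact
  support for which, at each fixed \<open>z\<close> of the shell, \<open>F z\<close> is unlikely to be near any prescribed value.

  \<^emph>\<open>The random operator.\<close> In each shell \<open>Z\<close> is covered by about \<open>j powr a\<close> balls whose radius is a fixed
  proportion of \<open>2 powr - j\<close> (\<open>homogeneous_probe_vectors\<close>). The normalised centres, multiplied
  with independent coefficients uniform in the unit ball of the target space, form a random block of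
  rank-one operators; \<open>F\<close> is the sum of these blocks with weights \<open>j powr - q\<close>. Orthogonality of the
  coefficients makes the \<open>j\<close>-th block of typical norm \<open>j powr (a / 2)\<close>
  (\<open>measure_sum_rank_one_gt_le\<close>), and by Chebyshev's inequality all blocks are simultaneously below
  thresholds slightly larger than \<open>j powr ((1 + a) / 2)\<close> with probability at least one half. Conditioned
  on this event the series converges uniformly when \<open>q > (3 + a) / 2\<close>, so its law has compact support
  (\<open>random_blinfun_exists\<close>). Every \<open>z\<close> of the shell has an inner product comparable to \<open>norm z\<close>
  with some centre; freezing all coefficients but the one of that centre shows that \<open>F z\<close> lies in a
  given ball of radius \<open>d\<close> with probability of order \<open>(d * j powr q / norm z) ^ N\<close>
  (\<open>random_blinfun_small_ball\<close>).

  \<^emph>\<open>The union bound.\<close> For a translation \<open>v\<close> and \<open>\<epsilon> > 0\<close>, a failure of \<open>F - v\<close> in the shell at the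
  level \<open>\<epsilon> * norm z / j powr \<gamma>\<close> is detected on a net of mesh proportional to that level, which has about
  \<open>(j powr \<gamma> / \<epsilon>) powr s * j powr a\<close> points up to logarithms of \<open>\<epsilon>\<close>. Multiplied with the small-ball
  probability this gives \<open>\<epsilon> powr (N - s) * j powr (\<gamma> * s + a + N * (q - \<gamma>))\<close>. The exponent of \<open>j\<close> is below
  \<open>-1\<close> for some \<open>q > (3 + a) / 2\<close> precisely when \<open>\<gamma>\<close> exceeds
  \<open>(2 + N * (3 + a) + 2 * a) / (2 * (N - s))\<close>; then the sum over \<open>j\<close> converges and tends to \<open>0\<close> with
  \<open>\<epsilon>\<close> (\<open>translate_log_lower_bounded_full\<close>). Only the constants depend on \<open>v\<close>, so the good operators
  are prevalent.
\<close>

section \<open>Logarithmic scales and covers\<close>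

lemma slog_ge_ln_2:
  assumes "0 < x" shows "ln 2 \<le> slog x"
proof -
  have "0 \<le> (x - 1)\<^sup>2 / x" using assms by simp
  also have "\<dots> = x + inverse x - 2"
    using assms by (simp add: field_simps power2_eq_square)
  finally show ?thesis unfolding slog_def by simp
qed

lemma slog_pos: "0 < x \<Longrightarrow> 0 < slog x"
  using slog_ge_ln_2[of x] by (smt (verit) ln_gt_zero)

lemma slog_ge_minus_ln:
  assumes "0 < x" shows "- ln x \<le> slog x"
proof -
  have "ln (inverse x) \<le> ln (x + inverse x)" using assms by (intro ln_mono) (auto intro: add_pos_pos)
  then show ?thesis using assms by (simp add: slog_def ln_inverse)
qed

lemma slog_le:
  assumes "0 < x" "x \<le> R" shows "slog x \<le> ln (R\<^sup>2 + 1) - ln x"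
proof -
  have "x + inverse x = (x\<^sup>2 + 1) / x"
    using assms by (simp add: field_simps power2_eq_square)
  then have "slog x = ln (x\<^sup>2 + 1) - ln x"
    using assms by (simp add: slog_def ln_div add_nonneg_eq_0_iff)
  also have "ln (x\<^sup>2 + 1) \<le> ln (R\<^sup>2 + 1)"
    using assms by (simp add: add_nonneg_pos power_mono)
  finally show ?thesis by simp
qed

text \<open>Two lower bounds for the symmetric logarithm are combined: \<open>- ln x\<close> grows
  linearly in the dyadic index \<open>j\<close>, up to the additive constant \<open>ln R\<close>, and the uniform bound
  \<open>ln 2\<close> absorbs that constant. Hence a negative power of \<open>slog\<close> on the
  \<open>j\<close>-th dyadic shell is at most a constant times the same power of \<open>Suc j\<close>.\<close>

lemma Suc_le_slog_dyadic:
  assumes "1 \<le> R"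
  obtains C where "0 < C" "\<And>j x. 0 < x \<Longrightarrow> x \<le> R / 2 ^ j \<Longrightarrow> real (Suc j) \<le> C * slog x"
proof
  let ?C = "1 / ln 2 + (ln R + ln 2) / (ln 2 * ln 2) :: real"
  show "0 < ?C" using assms by (simp add: add_pos_nonneg)
  fix j and x :: real assume x: "0 < x" "x \<le> R / 2 ^ j"
  have "ln x \<le> ln (R / 2 ^ j)" using x by simp
  also have "\<dots> = ln R - j * ln 2" using assms by (simp add: ln_div ln_realpow)
  finally have "j * ln 2 \<le> slog x + ln R" using slog_ge_minus_ln[OF x(1)] by simp
  then have "real (Suc j) * ln 2 \<le> slog x + (ln R + ln 2) * 1" by (simp add: algebra_simps)
  also have "\<dots> \<le> slog x + (ln R + ln 2) * (slog x / ln 2)"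
    using slog_ge_ln_2[OF x(1)] assms by (intro add_left_mono mult_left_mono) auto
  finally have "real (Suc j) \<le> (slog x + (ln R + ln 2) * (slog x / ln 2)) / ln 2"
    by (simp add: pos_le_divide_eq)
  also have "\<dots> = ?C * slog x" by (simp add: field_simps)
  finally show "real (Suc j) \<le> ?C * slog x" .
qed

lemma slog_dyadic_le:
  assumes "1 \<le> R" "0 < \<theta>" "\<theta> \<le> 1"
  shows "slog (\<theta> * (R / 2 ^ j)) \<le> (ln (R\<^sup>2 + 1) + 1) * real (Suc j) - ln \<theta>"
proof -
  have "\<theta> * (R / 2 ^ j) \<le> 1 * (R / 1)"
    using assms by (intro mult_mono divide_left_mono) auto
  then have "slog (\<theta> * (R / 2 ^ j)) \<le> ln (R\<^sup>2 + 1) - ln (\<theta> * (R / 2 ^ j))"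
    using assms by (intro slog_le) auto
  also have "\<dots> = ln (R\<^sup>2 + 1) - ln \<theta> - ln R + j * ln 2"
    using assms by (simp add: ln_mult ln_div ln_realpow)
  also have "\<dots> \<le> ln (R\<^sup>2 + 1) + real j * 1 - ln \<theta>"
    using assms ln_2_less_1 mult_left_mono[of "ln 2" 1 "real j"] ln_ge_zero[of R] by linarith
  also have "\<dots> \<le> (ln (R\<^sup>2 + 1) + 1) * real (Suc j) - ln \<theta>"
    using assms by (simp add: algebra_simps)
  finally show ?thesis .
qed

lemma dyadic_scale_exists:
  fixes x R :: real
  assumes "0 < x" "x < R"
  obtains j where "R / 2 ^ Suc j \<le> x" "x < R / 2 ^ j"
proof -
  define P where "P j \<longleftrightarrow> R / 2 ^ j \<le> x" for j :: nat
  obtain k :: nat where "R / x < 2 ^ k" using real_arch_pow[of 2 "R / x"] by auto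
  then have k: "P k" unfolding P_def using assms by (simp add: field_simps)
  have "\<not> P 0" unfolding P_def using assms by simp
  then obtain j where "\<not> P j" "P (Suc j)" using k by (metis not0_implies_Suc LeastI Least_le Suc_n_not_le_n)
  then show thesis using that[of j] by (simp add: P_def)
qed

text \<open>The finite real bound forces the infimum defining the covering number to be taken over
  a nonempty set of naturals, so it is attained; this turns the inequality between extended numbers
  into an actual finite net.\<close>

lemma almost_Ms_homogeneousD:
  assumes "almost_Ms_homogeneous \<alpha> \<beta> M s Y" "0 < \<rho>" "\<rho> < r" "y \<in> Y"
  obtains C where "C \<subseteq> Y" "finite C" "ball y r \<inter> Y \<subseteq> (\<Union>c\<in>C. ball c \<rho>)"
    "real (card C) \<le> M * (r / \<rho>) powr s * slog r powr \<beta> * slog \<rho> powr \<alpha>"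
proof -
  let ?b = "M * (r / \<rho>) powr s * slog r powr \<beta> * slog \<rho> powr \<alpha>"
  let ?A = "{n. \<forall>y\<in>Y. \<exists>C. C \<subseteq> Y \<and> finite C \<and> card C \<le> n \<and>
                        ball y r \<inter> Y \<subseteq> (\<Union>c\<in>C. ball c \<rho> \<inter> Y)}"
  have le: "ereal_of_enat (covering_number Y r \<rho>) \<le> ereal ?b"
    using assms unfolding almost_Ms_homogeneous_def by blast
  then have "covering_number Y r \<rho> \<noteq> \<infinity>" by (intro notI) simp
  then have "enat ` ?A \<noteq> {}" 
    unfolding covering_number_def Inf_enat_def by metis
  then have "covering_number Y r \<rho> \<in> enat ` ?A"
    unfolding covering_number_def Inf_enat_def by (metis (mono_tags, lifting) LeastI all_not_in_conv)
  then obtain n where n: "n \<in> ?A" "covering_number Y r \<rho> = enat n" by auto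
  then obtain C where C: "C \<subseteq> Y" "finite C" "card C \<le> n" "ball y r \<inter> Y \<subseteq> (\<Union>c\<in>C. ball c \<rho> \<inter> Y)"
    using assms(4) by blast
  have "real n \<le> ?b" using le n(2) by simp
  with C show thesis by (intro that[of C]) auto
qed

lemma summable_Suc_powr: "p < -1 \<Longrightarrow> summable (\<lambda>j. real (Suc j) powr p)"
  using summable_Suc_iff[of "\<lambda>n. real n powr p"] by (simp add: summable_real_powr_iff)

lemma exp_decay_beats_powr:
  assumes "0 < (\<kappa>::real)"
  shows "((\<lambda>t::real. exp (- \<kappa> * t) * (1 + t) powr \<alpha>) \<longlongrightarrow> 0) at_top"
  using assms by real_asymp

section \<open>The uniform distribution on the unit ball\<close>

definition ball_measure :: "'e::euclidean_space measure" where
  "ball_measure = uniform_measure lborel (cball 0 1)"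

lemma sets_ball_measure [simp, measurable_cong]: "sets ball_measure = sets borel"
  by (simp add: ball_measure_def)

lemma space_ball_measure [simp]: "space ball_measure = UNIV"
  by (simp add: ball_measure_def)

lemma emeasure_lborel_unit_cball:
  "emeasure lborel (cball (0::'e::euclidean_space) 1) \<noteq> 0"
  "emeasure lborel (cball (0::'e::euclidean_space) 1) \<noteq> \<infinity>"
proof -
  have "0 < measure lborel (cball (0::'e) 1)"
    using content_cball_pos[of 1 "0::'e"] by simp
  then show "emeasure lborel (cball (0::'e::euclidean_space) 1) \<noteq> 0"
    by (auto simp: measure_def)
  show "emeasure lborel (cball (0::'e::euclidean_space) 1) \<noteq> \<infinity>"
    using emeasure_lborel_cball_finite[of "0::'e" 1] by auto
qed

lemma prob_space_ball_measure: "prob_space ball_measure"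
  unfolding ball_measure_def
  using emeasure_lborel_unit_cball by (rule prob_space_uniform_measure)

lemma AE_ball_measure: "AE x in ball_measure. norm x \<le> 1"
  unfolding ball_measure_def
  using emeasure_lborel_unit_cball by (intro AE_uniform_measureI) auto

lemma ball_measure_cball_le:
  fixes a :: "'e::euclidean_space"
  assumes "0 \<le> r"
  shows "emeasure ball_measure (cball a r) \<le> ennreal (r ^ DIM('e))"
proof -
  let ?V = "measure lborel (cball (0::'e) 1)"
  have V: "0 < ?V" using content_cball_pos[of 1 "0::'e"] by simp
  have fin: "emeasure lborel (cball c t) = ennreal (measure lborel (cball c t))" for c :: 'e and t
    using emeasure_lborel_cball_finite[of c t] by (intro emeasure_eq_ennreal_measure) auto
  have vol: "measure lborel (cball a r) = r ^ DIM('e) * ?V"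
    using content_ball_conv_unit_ball[OF assms, of a] content_cball_conv_ball[of a r]
      content_cball_conv_ball[of "0::'e" 1] by simp
  have "emeasure ball_measure (cball a r) =
      emeasure lborel (cball 0 1 \<inter> cball a r) / emeasure lborel (cball (0::'e) 1)"
    unfolding ball_measure_def by (subst emeasure_uniform_measure) auto
  also have "\<dots> \<le> emeasure lborel (cball a r) / emeasure lborel (cball (0::'e) 1)"
    by (intro divide_right_mono_ennreal emeasure_mono) auto
  also have "\<dots> = ennreal (r ^ DIM('e))"
    using V assms by (simp add: fin vol divide_ennreal)
  finally show ?thesis .
qed

lemma distr_lborel_uminus: "distr lborel borel uminus = (lborel :: 'e::euclidean_space measure)"
  using lborel_affine[of "-1" "0::'e"] by (simp add: density_1)

text \<open>The distribution is invariant under \<open>x \<mapsto> - x\<close>.\<close>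

lemma expectation_ball_measure:
  fixes b :: "'e::euclidean_space"
  shows "(\<integral>x. x \<bullet> b \<partial>ball_measure) = 0"
proof -
  have eq: "(\<integral>x. f x \<partial>(ball_measure :: 'e measure)) =
      (\<integral>x. indicator (cball 0 1) x * f x \<partial>lborel) / measure lborel (cball (0::'e) 1)"
    if "f \<in> borel_measurable borel" for f :: "'e \<Rightarrow> real"
  proof -
    have [measurable]: "f \<in> borel_measurable borel" by fact
    have dens: "ball_measure = density lborel (\<lambda>x. ennreal (indicator (cball (0::'e) 1) x / measure lborel (cball (0::'e) 1)))"
      unfolding ball_measure_def uniform_measure_def
      using emeasure_lborel_unit_cball[where 'e='e] content_cball_pos[of 1 "0::'e"]
      by (intro density_cong) (auto simp: emeasure_eq_ennreal_measure divide_ennreal indicator_def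
          simp flip: ennreal_1)
    have "(\<integral>x. f x \<partial>(ball_measure :: 'e measure)) =
        (\<integral>x. indicator (cball 0 1) x / measure lborel (cball (0::'e) 1) * f x \<partial>lborel)"
    proof (subst dens, subst integral_real_density)
      show "(\<lambda>x. indicator (cball 0 1) x / measure lborel (cball (0::'e) 1)) \<in> borel_measurable lborel"
        by (intro borel_measurable_divide borel_measurable_indicator) auto
    qed (use that in auto)
    then show ?thesis by simp
  qed
  let ?I = "\<integral>x. indicator (cball 0 1) x * (x \<bullet> b) \<partial>lborel"
  have "?I = (\<integral>x. indicator (cball 0 1) x * (x \<bullet> b) \<partial>distr lborel borel uminus)"
    by (simp add: distr_lborel_uminus)
  also have "\<dots> = (\<integral>x. indicator (cball 0 1) (- x) * ((- x) \<bullet> b) \<partial>lborel)"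
  proof (rule integral_distr)
    show "(\<lambda>x. indicator (cball 0 1) x * (x \<bullet> b)) \<in> borel_measurable borel"
      by (intro borel_measurable_times borel_measurable_indicator) auto
  qed simp
  also have "\<dots> = - ?I"
    by (simp add: indicator_def if_distrib flip: integral_minus cong: if_cong)
  finally have "?I = 0" by simp
  then show ?thesis by (subst eq) auto
qed

section \<open>Independent coefficients\<close>

text \<open>An infinite product of copies of \<open>M\<close> is the product of one copy with the product over
  the remaining indices. Both uses of independence below, the small-ball estimate and the
  orthogonality of coordinates, are Fubini arguments through this decomposition.\<close>

lemma PiM_split_coordinate:
  fixes M :: "'e measure" and m :: 'i
  assumes "prob_space M"
  defines "N \<equiv> M \<Otimes>\<^sub>M PiM (UNIV - {m}) (\<lambda>_. M)"
  shows "(\<lambda>(x, X). X(m := x)) \<in> measurable N (PiM UNIV (\<lambda>_. M))"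
    and "distr N (PiM UNIV (\<lambda>_. M)) (\<lambda>(x, X). X(m := x)) = PiM UNIV (\<lambda>_. M)"
proof -
  have U: "insert m (UNIV - {m}) = UNIV" by auto
  show "(\<lambda>(x, X). X(m := x)) \<in> measurable N (PiM UNIV (\<lambda>_. M))"
    using measurable_fun_upd[of UNIV "UNIV - {m}" m snd N "\<lambda>_. M" fst]
    by (simp add: U N_def case_prod_beta')
  show "distr N (PiM UNIV (\<lambda>_. M)) (\<lambda>(x, X). X(m := x)) = PiM UNIV (\<lambda>_. M)"
    using distr_pair_PiM_eq_PiM[of "UNIV - {m}" "\<lambda>_. M" m] assms(1) by (simp add: U N_def)
qed

text \<open>If, with all other coordinates frozen, \<open>A\<close> pins the coordinate \<open>m\<close> down to a set of
  diameter at most \<open>d\<close>, then every slice in that direction lies in a closed ball of radius \<open>d\<close> around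
  any of its points, and Fubini gives the bound. Using the diameter rather than an explicit formula for
  the slice allows \<open>A\<close> to contain further constraints that couple all the coordinates.\<close>

lemma emeasure_PiM_slice_le:
  fixes M :: "'e::metric_space measure" and A :: "('i \<Rightarrow> 'e) set"
  assumes M: "prob_space M" and sets_M: "sets M = sets borel"
    and A: "A \<in> sets (PiM UNIV (\<lambda>_. M))"
    and small: "\<And>a. emeasure M (cball a d) \<le> c"
    and slice: "\<And>u u'. u \<in> A \<Longrightarrow> u' \<in> A \<Longrightarrow> (\<And>i. i \<noteq> m \<Longrightarrow> u i = u' i) \<Longrightarrow> dist (u m) (u' m) \<le> d"
  shows "emeasure (PiM UNIV (\<lambda>_. M)) A \<le> c"
proof -
  interpret M: prob_space M by fact
  let ?J = "UNIV - {m}" and ?f = "\<lambda>(x, X). X(m := x)"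
  interpret J: prob_space "PiM ?J (\<lambda>_. M)" by (intro prob_space_PiM M)
  interpret P: pair_sigma_finite M "PiM ?J (\<lambda>_. M)" ..
  note f = PiM_split_coordinate(1)[OF M, of m]
  let ?B = "?f -` A \<inter> space (M \<Otimes>\<^sub>M PiM ?J (\<lambda>_. M))"
  have B: "?B \<in> sets (M \<Otimes>\<^sub>M PiM ?J (\<lambda>_. M))"
    using f A by (rule measurable_sets)
  have "emeasure (PiM UNIV (\<lambda>_. M)) A =
      emeasure (distr (M \<Otimes>\<^sub>M PiM ?J (\<lambda>_. M)) (PiM UNIV (\<lambda>_. M)) ?f) A"
    by (simp only: PiM_split_coordinate(2)[OF M])
  also have "\<dots> = emeasure (M \<Otimes>\<^sub>M PiM ?J (\<lambda>_. M)) ?B"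
    using A by (intro emeasure_distr f)
  also have "\<dots> = (\<integral>\<^sup>+X. emeasure M ((\<lambda>x. (x, X)) -` ?B) \<partial>PiM ?J (\<lambda>_. M))"
    using B by (rule P.emeasure_pair_measure_alt2)
  also have "\<dots> \<le> (\<integral>\<^sup>+X. c \<partial>PiM ?J (\<lambda>_. M))"
  proof (rule nn_integral_mono)
    fix X
    show "emeasure M ((\<lambda>x. (x, X)) -` ?B) \<le> c"
    proof (cases "(\<lambda>x. (x, X)) -` ?B = {}")
      case False
      then obtain a where a: "X(m := a) \<in> A" by auto
      have "(\<lambda>x. (x, X)) -` ?B \<subseteq> cball a d"
      proof
        fix x assume "x \<in> (\<lambda>x. (x, X)) -` ?B"
        then have "X(m := x) \<in> A" by auto
        from slice[OF a this] show "x \<in> cball a d" by auto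
      qed
      then have "emeasure M ((\<lambda>x. (x, X)) -` ?B) \<le> emeasure M (cball a d)"
        by (intro emeasure_mono) (auto simp: sets_M)
      with small[of a] show ?thesis by (rule order_trans[rotated])
    qed simp
  qed
  also have "\<dots> = c" using J.emeasure_space_1 by simp
  finally show ?thesis .
qed

lemma AE_PiM_ball_measure:
  "AE u in PiM UNIV (\<lambda>_::'i. ball_measure). norm (u i :: 'e::euclidean_space) \<le> 1"
  by (rule AE_PiM_component[of UNIV "\<lambda>_. ball_measure"])
    (auto intro: prob_space_ball_measure AE_ball_measure)

lemma integrable_inner_PiM:
  "integrable (PiM UNIV (\<lambda>_::'i. ball_measure)) (\<lambda>u. u i \<bullet> (u k :: 'e::euclidean_space))"
proof -
  interpret P: prob_space "PiM UNIV (\<lambda>_::'i. ball_measure :: 'e measure)"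
    by (intro prob_space_PiM prob_space_ball_measure)
  show ?thesis
  proof (rule P.integrable_const_bound[where B = 1])
    show "AE u in PiM UNIV (\<lambda>_::'i. ball_measure). norm (u i \<bullet> (u k :: 'e)) \<le> 1"
      using AE_PiM_ball_measure[of i] AE_PiM_ball_measure[of k]
    proof eventually_elim
      case (elim u)
      have "\<bar>u i \<bullet> u k\<bar> \<le> norm (u i) * norm (u k)" by (rule Cauchy_Schwarz_ineq2)
      also have "\<dots> \<le> 1 * 1" using elim by (intro mult_mono) auto
      finally show ?case by simp
    qed
    show "(\<lambda>u. u i \<bullet> u k) \<in> borel_measurable (PiM UNIV (\<lambda>_::'i. ball_measure :: 'e measure))"
      by measurable
  qed
qed

lemma expectation_inner_PiM:
  assumes "i \<noteq> k"
  shows "(\<integral>u. u i \<bullet> u k \<partial>PiM UNIV (\<lambda>_::'i. ball_measure :: 'e::euclidean_space measure)) = 0"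
proof -
  let ?M = "ball_measure :: 'e measure" and ?J = "UNIV - {i}" and ?f = "\<lambda>(x, X). X(i := x)"
  interpret M: prob_space ?M by (rule prob_space_ball_measure)
  interpret J: prob_space "PiM ?J (\<lambda>_. ?M)" by (intro prob_space_PiM M.prob_space_axioms)
  interpret P: pair_sigma_finite ?M "PiM ?J (\<lambda>_. ?M)" ..
  note f = PiM_split_coordinate(1)[OF M.prob_space_axioms, of i]
  note D = PiM_split_coordinate(2)[OF M.prob_space_axioms, of i]
  have meas: "(\<lambda>u. u i \<bullet> u k) \<in> borel_measurable (PiM UNIV (\<lambda>_. ?M))" by measurable
  have int: "integrable (?M \<Otimes>\<^sub>M PiM ?J (\<lambda>_. ?M)) (\<lambda>(x, X). x \<bullet> X k)"
    using integrable_inner_PiM[of i k, where 'e='e] assms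
    by (subst (asm) D[symmetric], subst (asm) integrable_distr_eq[OF f meas])
      (simp add: case_prod_beta')
  have "(\<integral>u. u i \<bullet> u k \<partial>PiM UNIV (\<lambda>_. ?M)) =
      (\<integral>p. ?f p i \<bullet> ?f p k \<partial>(?M \<Otimes>\<^sub>M PiM ?J (\<lambda>_. ?M)))"
    by (subst D[symmetric], rule integral_distr[OF f meas])
  also have "\<dots> = (\<integral>(x, X). x \<bullet> X k \<partial>(?M \<Otimes>\<^sub>M PiM ?J (\<lambda>_. ?M)))"
    using assms by (simp add: case_prod_beta')
  also have "\<dots> = (\<integral>X. (\<integral>x. x \<bullet> X k \<partial>?M) \<partial>PiM ?J (\<lambda>_. ?M))"
    using P.integral_snd[OF int] by simp
  also have "\<dots> = 0" by (simp add: expectation_ball_measure)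
  finally show ?thesis .
qed

section \<open>Random sums of rank-one operators\<close>

definition rank_one :: "'h::real_inner \<Rightarrow> 'e::real_normed_vector \<Rightarrow> 'h \<Rightarrow>\<^sub>L 'e" where
  "rank_one a b = blinfun_scaleR_left b o\<^sub>L blinfun_inner_left a"

lemma rank_one_apply [simp]: "blinfun_apply (rank_one a b) x = (x \<bullet> a) *\<^sub>R b"
  by (simp add: rank_one_def)

lemma rank_one_diff: "rank_one a (b - c) = rank_one a b - rank_one a c"
  by (rule blinfun_eqI) (simp add: blinfun.diff_left scaleR_diff_right)

lemma continuous_on_rank_one [continuous_intros]:
  assumes "continuous_on S f"
  shows "continuous_on S (\<lambda>x. rank_one a (f x))"
  unfolding rank_one_def by (intro continuous_intros assms bounded_linear.continuous_on[OF bounded_linear_blinfun_scaleR_left])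

text \<open>The right-hand side is the squared Hilbert--Schmidt norm of the operator, written as a
  double sum. It is quadratic in the \<open>u i\<close>, so its expectation can be computed, unlike that of
  the operator norm.\<close>

lemma norm_sum_rank_one_le:
  fixes u :: "'i \<Rightarrow> 'e::euclidean_space" and e :: "'i \<Rightarrow> 'h::real_inner"
  shows "(norm (\<Sum>i\<in>I. rank_one (e i) (u i)))\<^sup>2 \<le> (\<Sum>i\<in>I. \<Sum>k\<in>I. (u i \<bullet> u k) * (e i \<bullet> e k))"
proof -
  \<comment> \<open>Component \<open>b\<close> of the operator is the inner product with \<open>y b\<close>.\<close>
  define y where "y b = (\<Sum>i\<in>I. (u i \<bullet> b) *\<^sub>R e i)" for b
  let ?Q = "\<Sum>b\<in>Basis. (norm (y b))\<^sup>2"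
  have Q: "?Q = (\<Sum>i\<in>I. \<Sum>k\<in>I. (u i \<bullet> u k) * (e i \<bullet> e k))"
  proof -
    have "?Q = (\<Sum>b\<in>Basis. \<Sum>i\<in>I. \<Sum>k\<in>I. ((u i \<bullet> b) * (u k \<bullet> b)) * (e i \<bullet> e k))"
      unfolding y_def power2_norm_eq_inner
      by (simp add: inner_sum_left inner_sum_right mult.assoc)
        (auto simp: sum_distrib_left inner_commute[of "e _" "e _"] intro!: sum.cong)
    also have "\<dots> = (\<Sum>i\<in>I. \<Sum>k\<in>I. \<Sum>b\<in>Basis. ((u i \<bullet> b) * (u k \<bullet> b)) * (e i \<bullet> e k))"
      by (subst sum.swap, intro sum.cong refl, subst sum.swap, rule refl)
    also have "\<dots> = (\<Sum>i\<in>I. \<Sum>k\<in>I. (u i \<bullet> u k) * (e i \<bullet> e k))"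
      by (subst euclidean_inner[where 'a='e]) (simp add: sum_distrib_right)
    finally show ?thesis .
  qed
  have "norm (\<Sum>i\<in>I. rank_one (e i) (u i)) \<le> sqrt ?Q"
  proof (rule norm_blinfun_bound)
    fix x :: 'h
    let ?v = "blinfun_apply (\<Sum>i\<in>I. rank_one (e i) (u i)) x"
    have v: "?v \<bullet> b = x \<bullet> y b" for b
      by (simp add: blinfun.sum_left inner_sum_left inner_sum_right y_def mult.commute)
    have "(norm ?v)\<^sup>2 = (\<Sum>b\<in>Basis. (?v \<bullet> b)\<^sup>2)"
      unfolding power2_norm_eq_inner by (subst euclidean_inner) (simp add: power2_eq_square)
    also have "\<dots> \<le> (\<Sum>b\<in>Basis. (norm x)\<^sup>2 * (norm (y b))\<^sup>2)"
      unfolding v by (intro sum_mono) (metis Cauchy_Schwarz_ineq power2_norm_eq_inner)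
    also have "\<dots> = (sqrt ?Q * norm x)\<^sup>2"
      by (simp add: power_mult_distrib sum_nonneg sum_distrib_left mult.commute)
    finally show "norm ?v \<le> sqrt ?Q * norm x"
      by (rule power2_le_imp_le) (simp add: sum_nonneg)
  qed (simp add: sum_nonneg)
  then have "(norm (\<Sum>i\<in>I. rank_one (e i) (u i)))\<^sup>2 \<le> (sqrt ?Q)\<^sup>2"
    by (intro power_mono) auto
  then show ?thesis by (simp add: Q sum_nonneg flip: Q)
qed

lemma sets_PiM_ball_measure:
  "sets (PiM UNIV (\<lambda>_::'i::countable. ball_measure :: 'e::euclidean_space measure)) = sets borel"
  unfolding sets_PiM_equal_borel[symmetric] by (intro sets_PiM_cong) auto

lemma continuous_on_sum_rank_one:
  "continuous_on S (\<lambda>u. \<Sum>i\<in>I. rank_one (e i) (u (g i)))"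
  by (intro continuous_on_sum continuous_on_rank_one
      continuous_on_subset[OF continuous_on_product_coordinates]) auto

text \<open>Independent centred coefficients make the cross terms of the Hilbert--Schmidt norm vanish
  on average, so a sum of \<open>card I\<close> unit rank-one operators has typical size \<open>sqrt (card I)\<close> rather
  than \<open>card I\<close>. This square root is what the exponent of the logarithm depends on. The vectors \<open>e i\<close>
  may be arbitrary: no orthogonalisation is involved.\<close>

lemma measure_sum_rank_one_gt_le:
  fixes e :: "'i::countable \<Rightarrow> 'h::real_inner"
  assumes I: "finite I" and e: "\<And>i. i \<in> I \<Longrightarrow> norm (e i) \<le> 1" and T: "0 < T"
  shows "measure (PiM UNIV (\<lambda>_. ball_measure :: 'e::euclidean_space measure))
      {u. T < norm (\<Sum>i\<in>I. rank_one (e i) (u i))} \<le> card I / T\<^sup>2"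
proof -
  let ?P = "PiM UNIV (\<lambda>_::'i. ball_measure :: 'e measure)"
  interpret P: prob_space ?P by (intro prob_space_PiM prob_space_ball_measure)
  let ?q = "\<lambda>u::'i \<Rightarrow> 'e. \<Sum>i\<in>I. \<Sum>k\<in>I. (u i \<bullet> u k) * (e i \<bullet> e k)"
  have sp: "space ?P = UNIV" by (simp add: space_PiM)
  have int: "integrable ?P ?q"
    by (intro Bochner_Integration.integrable_sum integrable_mult_left integrable_inner_PiM)
  have diag: "(\<integral>u. u i \<bullet> u i \<partial>?P) \<le> 1" for i
  proof -
    have "(\<integral>u. u i \<bullet> u i \<partial>?P) \<le> (\<integral>u. 1 \<partial>?P)"
    proof (rule integral_mono_AE)
      show "AE u in ?P. u i \<bullet> u i \<le> 1"
        using AE_PiM_ball_measure[of i, where 'e='e]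
        by eventually_elim (simp add: dot_square_norm power_le_one)
    qed (simp_all add: integrable_inner_PiM)
    then show ?thesis by (simp add: P.prob_space)
  qed
  have "(\<integral>u. ?q u \<partial>?P) = (\<Sum>i\<in>I. \<Sum>k\<in>I. (\<integral>u. u i \<bullet> u k \<partial>?P) * (e i \<bullet> e k))"
    by (simp add: Bochner_Integration.integral_sum integrable_inner_PiM)
  also have "\<dots> = (\<Sum>i\<in>I. (\<integral>u. u i \<bullet> u i \<partial>?P) * (e i \<bullet> e i))"
  proof (rule sum.cong[OF refl])
    fix i assume "i \<in> I"
    have "(\<Sum>k\<in>I. (\<integral>u. u i \<bullet> u k \<partial>?P) * (e i \<bullet> e k)) =
        (\<Sum>k\<in>I. if k = i then (\<integral>u. u i \<bullet> u i \<partial>?P) * (e i \<bullet> e i) else 0)"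
      by (intro sum.cong refl) (use expectation_inner_PiM[of i, where 'e='e] in auto)
    then show "(\<Sum>k\<in>I. (\<integral>u. u i \<bullet> u k \<partial>?P) * (e i \<bullet> e k)) = (\<integral>u. u i \<bullet> u i \<partial>?P) * (e i \<bullet> e i)"
      using I \<open>i \<in> I\<close> by simp
  qed
  also have "\<dots> \<le> (\<Sum>i\<in>I. 1)"
  proof (rule sum_mono)
    fix i assume "i \<in> I"
    have "e i \<bullet> e i \<le> 1" using e[OF \<open>i \<in> I\<close>] by (simp add: dot_square_norm power_le_one)
    then have "(\<integral>u. u i \<bullet> u i \<partial>?P) * (e i \<bullet> e i) \<le> 1 * 1"
      by (intro mult_mono diag) auto
    then show "(\<integral>u. u i \<bullet> u i \<partial>?P) * (e i \<bullet> e i) \<le> 1" by simp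
  qed
  finally have E: "(\<integral>u. ?q u \<partial>?P) \<le> card I" by simp
  have q0: "0 \<le> ?q u" for u
    using norm_sum_rank_one_le[of e u I] zero_le_power2 order_trans by blast
  have "measure ?P {u. T < norm (\<Sum>i\<in>I. rank_one (e i) (u i))} \<le> measure ?P {u\<in>space ?P. T\<^sup>2 \<le> ?q u}"
  proof (rule P.finite_measure_mono)
    show "{u. T < norm (\<Sum>i\<in>I. rank_one (e i) (u i))} \<subseteq> {u\<in>space ?P. T\<^sup>2 \<le> ?q u}"
    proof
      fix u assume "u \<in> {u::'i \<Rightarrow> 'e. T < norm (\<Sum>i\<in>I. rank_one (e i) (u i))}"
      then have "T\<^sup>2 \<le> (norm (\<Sum>i\<in>I. rank_one (e i) (u i)))\<^sup>2"
        using T by (intro power_mono) auto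
      also have "\<dots> \<le> ?q u" by (rule norm_sum_rank_one_le)
      finally show "u \<in> {u\<in>space ?P. T\<^sup>2 \<le> ?q u}" by (simp add: sp)
    qed
    show "{u\<in>space ?P. T\<^sup>2 \<le> ?q u} \<in> sets ?P" by measurable
  qed
  also have "\<dots> \<le> (\<integral>u. ?q u \<partial>?P) / T\<^sup>2"
    using T q0 by (intro integral_Markov_inequality_measure[OF int, where A = "{}"]) auto
  also have "\<dots> \<le> card I / T\<^sup>2" using E by (intro divide_right_mono) auto
  finally show ?thesis .
qed

text \<open>The random operator is \<open>\<Sum>j. w j *\<^sub>R (\<Sum>i<n j. rank_one (e j i) (u (j, i)))\<close> with
  independent coefficients \<open>u (j, i)\<close>, uniform in the unit ball of the target space. On the whole
  parameter space the series may diverge in norm. So the parameters are conditioned on the compact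
  set \<open>G\<close> where the \<open>j\<close>-th block has norm at most \<open>T j\<close> for every \<open>j\<close>. By the second-moment
  bound and the condition on \<open>n\<close> and \<open>T\<close> this set has probability at least one half, so
  conditioning at most doubles probabilities; on it the series converges uniformly, which makes the
  image compact. If the value at \<open>c\<close> is to lie in a given ball of radius \<open>d\<close>, then with the
  other coefficients frozen the coefficient \<open>u (j, i)\<close> is confined to a set of diameter
  \<open>2 * d / (w j * \<bar>c \<bullet> e j i\<bar>)\<close>, whatever the other terms of the series are.\<close>

theorem random_blinfun_exists:
  fixes e :: "nat \<Rightarrow> nat \<Rightarrow> 'h::real_inner" and n :: "nat \<Rightarrow> nat" and w T :: "nat \<Rightarrow> real"
  assumes e: "\<And>j i. norm (e j i) \<le> 1" and w: "\<And>j. 0 < w j" and T: "\<And>j. 0 < T j"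
    and wT: "summable (\<lambda>j. w j * T j)"
    and nT: "summable (\<lambda>j. n j / (T j)\<^sup>2)" "(\<Sum>j. n j / (T j)\<^sup>2) \<le> 1 / 2"
  obtains \<mu> :: "('h \<Rightarrow>\<^sub>L 'e::euclidean_space) measure" and K B
  where "sets \<mu> = sets borel" "prob_space \<mu>" "compact K" "emeasure \<mu> K = 1"
    "\<And>f. f \<in> K \<Longrightarrow> norm f \<le> B"
    "\<And>j i c a d. i < n j \<Longrightarrow> 0 < \<bar>c \<bullet> e j i\<bar> \<Longrightarrow> 0 \<le> d \<Longrightarrow>
      emeasure \<mu> {f. norm (blinfun_apply f c - a) \<le> d}
        \<le> ennreal (2 * (2 * d / (w j * \<bar>c \<bullet> e j i\<bar>)) ^ DIM('e))"
proof -
  let ?M = "ball_measure :: 'e measure"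
  define P where "P = PiM UNIV (\<lambda>_::nat \<times> nat. ?M)"
  interpret P: prob_space P
    unfolding P_def by (intro prob_space_PiM prob_space_ball_measure)
  have sets_P: "sets P = sets borel" unfolding P_def by (rule sets_PiM_ball_measure)
  have space_P: "space P = UNIV" by (simp add: P_def space_PiM)
  define \<phi> where "\<phi> j u = (\<Sum>i<n j. rank_one (e j i) (u (j, i)))" for j and u :: "nat \<times> nat \<Rightarrow> 'e"
  have cont_\<phi>: "continuous_on S (\<phi> j)" for S j
    unfolding \<phi>_def by (rule continuous_on_sum_rank_one)
  define cube :: "(nat \<times> nat \<Rightarrow> 'e) set" where "cube = PiE UNIV (\<lambda>_. cball 0 1)"
  have compact_cube: "compact cube"
    using compactin_PiE[of "\<lambda>_. euclidean" UNIV "\<lambda>_::nat\<times>nat. cball (0::'e) 1"]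
    by (simp add: cube_def euclidean_product_topology)
  define G where "G = cube \<inter> (\<Inter>j. {u. norm (\<phi> j u) \<le> T j})"
  have closed_\<phi>: "closed {u. norm (\<phi> j u) \<le> T j}" for j
    by (intro closed_Collect_le continuous_intros cont_\<phi>)
  have compact_G: "compact G"
    unfolding G_def using compact_cube closed_\<phi> by (intro compact_Int_closed) auto
  have closed_cube: "closed cube"
    by (rule compact_imp_closed[OF compact_cube])
  have closed_G: "closed G"
    unfolding G_def using closed_cube closed_\<phi> by (intro closed_Int closed_INT) auto
  have G_borel: "G \<in> sets borel" using closed_G by simp
  have cube_1: "AE u in P. u \<in> cube"
  proof -
    have "AE u in P. \<forall>i. norm (u i) \<le> 1"
      unfolding AE_all_countable P_def using AE_PiM_ball_measure by blast
    then show ?thesis by eventually_elim (auto simp: cube_def PiE_UNIV_domain)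
  qed
  have bad: "measure P {u. T j < norm (\<phi> j u)} \<le> n j / (T j)\<^sup>2" for j
  proof -
    have "\<phi> j u = (\<Sum>p\<in>Pair j ` {..<n j}. rank_one (e (fst p) (snd p)) (u p))" for u
      unfolding \<phi>_def by (subst sum.reindex) (auto simp: inj_on_def)
    then show ?thesis
      using measure_sum_rank_one_gt_le[of "Pair j ` {..<n j}" "\<lambda>p. e (fst p) (snd p)" "T j", where 'e='e] e T
      by (simp add: P_def card_image inj_on_def)
  qed
  have open_bad: "open {u. T j < norm (\<phi> j u)}" for j
    using closed_\<phi>[of j] by (simp add: closed_def Collect_neg_eq[symmetric] not_le)
  have half: "1 / 2 \<le> measure P G"
  proof -
    let ?U = "\<Union>j. {u. T j < norm (\<phi> j u)}"
    have sum: "summable (\<lambda>j. measure P {u. T j < norm (\<phi> j u)})"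
      using bad by (intro summable_comparison_test'[OF nT(1)]) auto
    have "measure P ?U \<le> (\<Sum>j. measure P {u. T j < norm (\<phi> j u)})"
      using open_bad sum by (intro P.finite_measure_subadditive_countably) (auto simp: sets_P)
    also have "\<dots> \<le> (\<Sum>j. n j / (T j)\<^sup>2)" by (intro suminf_le bad sum nT)
    finally have U: "measure P ?U \<le> 1 / 2" using nT(2) by simp
    have U_sets: "?U \<in> sets P" using open_bad by (auto simp: sets_P intro!: borel_open)
    have "measure P (space P - ?U) = measure P G"
    proof (rule P.finite_measure_eq_AE)
      show "AE u in P. (u \<in> space P - ?U) = (u \<in> G)"
        using cube_1 by eventually_elim (auto simp: G_def space_P not_less)
    qed (use U_sets G_borel sets_P in auto)
    with U U_sets show ?thesis by (simp add: P.prob_compl)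
  qed
  define F where "F u = (\<Sum>j. w j *\<^sub>R \<phi> j u)" for u
  have term_le: "norm (w j *\<^sub>R \<phi> j u) \<le> w j * T j" if "u \<in> G" for u j
    using that w[of j] by (auto simp: G_def intro!: mult_left_mono)
  have summable_F: "summable (\<lambda>j. w j *\<^sub>R \<phi> j u)" if "u \<in> G" for u
    using term_le[OF that] by (intro summable_comparison_test'[OF wT]) auto
  have cont_F: "continuous_on G F"
  proof (rule uniform_limit_theorem)
    show "uniform_limit G (\<lambda>m u. \<Sum>j<m. w j *\<^sub>R \<phi> j u) F sequentially"
      unfolding F_def by (rule Weierstrass_m_test[OF term_le wT])
    show "\<forall>\<^sub>F m in sequentially. continuous_on G (\<lambda>u. \<Sum>j<m. w j *\<^sub>R \<phi> j u)"
      by (intro always_eventually allI continuous_intros cont_\<phi>)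
  qed simp
  have norm_F: "norm (F u) \<le> (\<Sum>j. w j * T j)" if "u \<in> G" for u
  proof -
    have sn: "summable (\<lambda>j. norm (w j *\<^sub>R \<phi> j u))"
      using term_le[OF that] by (intro summable_comparison_test'[OF wT]) auto
    have "norm (F u) \<le> (\<Sum>j. norm (w j *\<^sub>R \<phi> j u))"
      unfolding F_def by (rule summable_norm[OF sn])
    also have "\<dots> \<le> (\<Sum>j. w j * T j)"
      by (intro suminf_le term_le[OF that] sn wT)
    finally show ?thesis .
  qed
  \<comment> \<open>Outside \<open>G\<close>, a null set after conditioning, any measurable extension will do.\<close>
  define F' where "F' u = (if u \<in> G then F u else 0)" for u
  have F': "F' \<in> borel_measurable borel"
    unfolding F'_def[abs_def]
    by (rule borel_measurable_continuous_on_if[OF G_borel cont_F]) auto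
  define Q where "Q = uniform_measure P G"
  have emG: "emeasure P G = ennreal (measure P G)" by (rule P.emeasure_eq_measure)
  have "emeasure P G \<noteq> 0" using half by (simp add: emG)
  then interpret Q: prob_space Q
    unfolding Q_def by (rule prob_space_uniform_measure) simp
  have sets_Q: "sets Q = sets borel" by (simp add: Q_def sets_P)
  have F'_Q: "F' \<in> measurable Q borel" using F' sets_Q by (simp cong: measurable_cong_sets)
  define \<mu> where "\<mu> = distr Q borel F'"
  interpret \<mu>: prob_space \<mu> unfolding \<mu>_def by (rule Q.prob_space_distr[OF F'_Q])
  have em: "emeasure \<mu> S = emeasure P {u \<in> G. F u \<in> S} / emeasure P G" if "S \<in> sets borel" for S
  proof -
    have "emeasure \<mu> S = emeasure Q (F' -` S \<inter> space Q)"
      unfolding \<mu>_def by (rule emeasure_distr[OF F'_Q that])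
    also have "\<dots> = emeasure P (G \<inter> (F' -` S \<inter> space Q)) / emeasure P G"
      unfolding Q_def using measurable_sets[OF F'_Q that] G_borel sets_P sets_Q
      by (intro emeasure_uniform_measure) (auto simp: Q_def)
    also have "G \<inter> (F' -` S \<inter> space Q) = {u \<in> G. F u \<in> S}"
      by (auto simp: F'_def Q_def space_P)
    finally show ?thesis .
  qed
  show thesis
  proof (rule that)
    show "sets \<mu> = sets borel" by (simp add: \<mu>_def)
    show "prob_space \<mu>" by (rule \<mu>.prob_space_axioms)
    show K: "compact (F ` G)" by (rule compact_continuous_image[OF cont_F compact_G])
    have "emeasure \<mu> (F ` G) = emeasure P {u \<in> G. F u \<in> F ` G} / emeasure P G"
      by (intro em borel_closed compact_imp_closed K)
    also have "{u \<in> G. F u \<in> F ` G} = G" by auto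
    also have "emeasure P G / emeasure P G = 1"
      using half by (simp add: emG divide_ennreal)
    finally show "emeasure \<mu> (F ` G) = 1" .
    show "norm f \<le> (\<Sum>j. w j * T j)" if "f \<in> F ` G" for f using that norm_F by auto
    fix j i c a and d :: real
    assume i: "i < n j" and c: "0 < \<bar>c \<bullet> e j i\<bar>" and d: "0 \<le> d"
    let ?S = "{f :: 'h \<Rightarrow>\<^sub>L 'e. norm (blinfun_apply f c - a) \<le> d}"
    let ?r = "2 * d / (w j * \<bar>c \<bullet> e j i\<bar>)"
    have S: "closed ?S" by (intro closed_Collect_le continuous_intros)
    have A_sets: "{u \<in> G. F u \<in> ?S} \<in> sets P"
    proof -
      have "closed (G \<inter> F -` ?S)"
        by (rule continuous_closed_preimage[OF cont_F closed_G S])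
      moreover have "G \<inter> F -` ?S = {u \<in> G. F u \<in> ?S}" by auto
      ultimately show ?thesis by (simp add: sets_P)
    qed
    have "emeasure P {u \<in> G. F u \<in> ?S} \<le> ennreal (?r ^ DIM('e))"
      unfolding P_def
    proof (rule emeasure_PiM_slice_le)
      show "prob_space ?M" by (rule prob_space_ball_measure)
      show "sets ?M = sets borel" by simp
      show "{u \<in> G. F u \<in> ?S} \<in> sets (PiM UNIV (\<lambda>_. ?M))" using A_sets by (simp add: P_def)
      show "emeasure ?M (cball x ?r) \<le> ennreal (?r ^ DIM('e))" for x
        using d w[of j] by (intro ball_measure_cball_le) auto
      fix u u' assume u: "u \<in> {u \<in> G. F u \<in> ?S}" and u': "u' \<in> {u \<in> G. F u \<in> ?S}"
        and eq: "\<And>p. p \<noteq> (j, i) \<Longrightarrow> u p = u' p"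
      have "F u - F u' = (\<Sum>k. w k *\<^sub>R \<phi> k u - w k *\<^sub>R \<phi> k u')"
        unfolding F_def using u u' by (intro suminf_diff summable_F) auto
      also have "\<dots> = (\<Sum>k. if k = j then w j *\<^sub>R rank_one (e j i) (u (j, i) - u' (j, i)) else 0)"
      proof (rule suminf_cong)
        fix k
        have "\<phi> k u - \<phi> k u' = (\<Sum>l<n k. rank_one (e k l) (u (k, l) - u' (k, l)))"
          by (simp add: \<phi>_def rank_one_diff sum_subtractf)
        also have "\<dots> = (\<Sum>l<n k. if k = j \<and> l = i then rank_one (e j i) (u (j, i) - u' (j, i)) else 0)"
          using eq by (intro sum.cong refl) (auto simp: rank_one_def blinfun_eqI)
        also have "\<dots> = (if k = j then rank_one (e j i) (u (j, i) - u' (j, i)) else 0)"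
          using i by auto
        finally show "w k *\<^sub>R \<phi> k u - w k *\<^sub>R \<phi> k u' =
            (if k = j then w j *\<^sub>R rank_one (e j i) (u (j, i) - u' (j, i)) else 0)"
          by (auto simp: simp flip: scaleR_diff_right)
      qed
      also have "\<dots> = w j *\<^sub>R rank_one (e j i) (u (j, i) - u' (j, i))"
        using sums_single[of j "\<lambda>_. w j *\<^sub>R rank_one (e j i) (u (j, i) - u' (j, i))"]
        by (simp add: sums_iff)
      finally have FF: "F u - F u' = w j *\<^sub>R rank_one (e j i) (u (j, i) - u' (j, i))" .
      have "w j * \<bar>c \<bullet> e j i\<bar> * norm (u (j, i) - u' (j, i)) = norm (blinfun_apply (F u - F u') c)"
        using w[of j] by (simp add: FF blinfun.scaleR_left abs_mult)
      also have "\<dots> = norm ((blinfun_apply (F u) c - a) - (blinfun_apply (F u') c - a))"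
        by (simp add: blinfun.diff_left)
      also have "\<dots> \<le> d + d" 
        by (rule order_trans[OF norm_triangle_ineq4 add_mono]) (use u u' in simp_all)
      finally show "dist (u (j, i)) (u' (j, i)) \<le> ?r"
        using w[of j] c by (simp add: dist_norm field_simps)
    qed
    then have "emeasure P {u \<in> G. F u \<in> ?S} / emeasure P G \<le> ennreal (?r ^ DIM('e)) / emeasure P G"
      by (rule divide_right_mono_ennreal)
    also have "\<dots> = ennreal (?r ^ DIM('e) / measure P G)"
      using d w[of j] half by (simp add: emG divide_ennreal)
    also have "\<dots> \<le> ennreal (2 * ?r ^ DIM('e))"
    proof (rule ennreal_leI)
      have "?r ^ DIM('e) * 1 \<le> ?r ^ DIM('e) * (2 * measure P G)"
        using d w[of j] half by (intro mult_left_mono) auto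
      then show "?r ^ DIM('e) / measure P G \<le> 2 * ?r ^ DIM('e)"
        using half by (simp add: pos_divide_le_eq mult_ac)
    qed
    finally show "emeasure \<mu> ?S \<le> ennreal (2 * ?r ^ DIM('e))"
      using em S by simp
  qed
qed

section \<open>Small-ball estimates on an almost homogeneous set\<close>

text \<open>The probe vectors of scale \<open>j\<close> are the normalised centres of a cover of \<open>Z\<close> inside the
  ball of radius \<open>R / 2 ^ j\<close> by balls of a fixed proportion of that radius. The ratio of the radii being
  constant, homogeneity leaves only the logarithmic factors, so \<open>(j + 1) powr (\<alpha> + \<beta>)\<close> vectors
  suffice, up to a constant. A point of norm at least half the radius is much longer than its distance to the nearest
  centre, hence points nearly in the direction of that centre.\<close>

lemma homogeneous_probe_vectors:
  fixes Z :: "'h::real_inner set"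
  assumes hom: "almost_Ms_homogeneous \<alpha> \<beta> M s Z" and M: "1 \<le> M"
    and ab: "0 \<le> \<alpha>" "0 \<le> \<beta>" and Z: "0 \<in> Z" and R: "1 \<le> R"
  obtains C n e where "0 < C" "\<And>j. real (n j) \<le> C * real (Suc j) powr (\<alpha> + \<beta>)"
    "\<And>j i. norm (e j i :: 'h) \<le> 1"
    "\<And>j z. z \<in> Z \<Longrightarrow> R / 2 ^ Suc j \<le> norm z \<Longrightarrow> norm z < R / 2 ^ j \<Longrightarrow>
      \<exists>i<n j. R / 2 ^ j / 4 \<le> z \<bullet> e j i"
proof -
  define D where "D = ln (R\<^sup>2 + 1) + 1"
  have D: "1 \<le> D" unfolding D_def using R by simp
  let ?C = "M * 8 powr s * D powr \<beta> * (D + ln 8) powr \<alpha>"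
  have "\<exists>A. finite A \<and> ball 0 (R / 2 ^ j) \<inter> Z \<subseteq> (\<Union>c\<in>A. ball c (R / 2 ^ j / 8)) \<and>
      real (card A) \<le> ?C * real (Suc j) powr (\<alpha> + \<beta>)" for j
  proof -
    let ?r = "R / 2 ^ j"
    have r: "0 < ?r" using R by simp
    obtain A where A: "A \<subseteq> Z" "finite A" "ball 0 ?r \<inter> Z \<subseteq> (\<Union>c\<in>A. ball c (?r / 8))"
      "real (card A) \<le> M * (?r / (?r / 8)) powr s * slog ?r powr \<beta> * slog (?r / 8) powr \<alpha>"
      using r by (rule_tac almost_Ms_homogeneousD[OF hom _ _ Z, of "?r / 8" ?r]) auto
    have s1: "slog ?r \<le> D * real (Suc j)"
      using slog_dyadic_le[OF R, of 1 j] by (simp add: D_def)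
    have "slog (?r / 8) \<le> D * real (Suc j) - ln (1 / 8)"
      using slog_dyadic_le[OF R, of "1 / 8" j] by (simp add: D_def mult.commute[of _ 8])
    also have "\<dots> = D * real (Suc j) + ln 8 * 1" by (simp add: ln_div)
    also have "\<dots> \<le> D * real (Suc j) + ln 8 * real (Suc j)" by (intro add_left_mono mult_left_mono) auto
    finally have s2: "slog (?r / 8) \<le> (D + ln 8) * real (Suc j)" by (simp add: algebra_simps)
    have "real (card A) \<le> M * 8 powr s * slog ?r powr \<beta> * slog (?r / 8) powr \<alpha>"
      using A(4) R by simp
    also have "\<dots> \<le> M * 8 powr s * (D * real (Suc j)) powr \<beta> * ((D + ln 8) * real (Suc j)) powr \<alpha>"
      using M s1 s2 ab slog_pos[of ?r] slog_pos[of "?r / 8"] r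
      by (intro mult_mono powr_mono2 mult_nonneg_nonneg order_refl) auto
    also have "\<dots> = ?C * real (Suc j) powr (\<alpha> + \<beta>)"
      using D by (simp add: powr_mult powr_add)
    finally show ?thesis using A(2,3) by blast
  qed
  then obtain A where A: "\<And>j. finite (A j)"
    "\<And>j. ball 0 (R / 2 ^ j) \<inter> Z \<subseteq> (\<Union>c\<in>A j. ball c (R / 2 ^ j / 8))"
    "\<And>j. real (card (A j)) \<le> ?C * real (Suc j) powr (\<alpha> + \<beta>)" by metis
  have "\<exists>h. bij_betw h {0..<card (A j)} (A j)" for j
    using A(1) by (rule ex_bij_betw_nat_finite)
  then obtain h where h: "\<And>j. bij_betw (h j) {0..<card (A j)} (A j)" by metis
  show thesis
  proof (rule that[of ?C "\<lambda>j. card (A j)" "\<lambda>j i. sgn (h j i)"])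
    have "0 < D + ln 8" using D by (intro add_pos_pos) auto
    then show "0 < ?C" using M D by (intro mult_pos_pos) auto
    show "real (card (A j)) \<le> ?C * real (Suc j) powr (\<alpha> + \<beta>)" for j by (rule A(3))
    show "norm (sgn (h j i)) \<le> 1" for j i by (simp add: norm_sgn)
    fix j z assume z: "z \<in> Z" "R / 2 ^ Suc j \<le> norm z" "norm z < R / 2 ^ j"
    let ?r = "R / 2 ^ j"
    have "z \<in> ball 0 ?r \<inter> Z" using z by simp
    then obtain c where c: "c \<in> A j" "norm (c - z) < ?r / 8" using A(2)[of j] by (auto simp: dist_norm)
    then have "c \<in> h j ` {0..<card (A j)}" using bij_betw_imp_surj_on[OF h, of j] by simp
    then obtain i where i: "i < card (A j)" "h j i = c" by auto
    have "z \<bullet> sgn c = norm c - (c - z) \<bullet> sgn c"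
      by (cases "c = 0") (auto simp: inner_diff_left sgn_div_norm dot_square_norm power2_eq_square field_simps)
    moreover have "(c - z) \<bullet> sgn c \<le> norm (c - z) * 1"
      by (rule order_trans[OF norm_cauchy_schwarz]) (auto simp: norm_sgn)
    moreover have "norm z \<le> norm c + norm (c - z)"
      by (metis norm_minus_commute norm_triangle_sub)
    ultimately have "?r / 4 \<le> z \<bullet> sgn c" using c(2) z(2) by simp
    then show "\<exists>i<card (A j). ?r / 4 \<le> z \<bullet> sgn (h j i)" using i by auto
  qed
qed

text \<open>The weights \<open>w j = (j + 1) powr - q\<close> and thresholds \<open>T j\<close> of order
  \<open>(j + 1) powr (1 / 2 + \<epsilon> + (\<alpha> + \<beta>) / 2)\<close> are balanced for the blocks of
  \<open>(j + 1) powr (\<alpha> + \<beta>)\<close> probe vectors: \<open>\<Sum>j. n j / (T j)\<^sup>2\<close> converges because \<open>T\<close> exceeds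
  the typical block size by \<open>(j + 1) powr (1 / 2 + \<epsilon>)\<close>, and \<open>\<Sum>j. w j * T j\<close> converges because
  \<open>q\<close> exceeds \<open>(3 + \<alpha> + \<beta>) / 2\<close>. The estimate holds for all \<open>c\<close> near a point \<open>z\<close> of \<open>Z\<close>,
  and not only for points of \<open>Z\<close> in the shell, because the centres of a fine cover need not lie in the
  shell.\<close>

lemma random_blinfun_small_ball:
  fixes Z :: "'h::real_inner set"
  assumes hom: "almost_Ms_homogeneous \<alpha> \<beta> M s Z" and M: "1 \<le> M"
    and ab: "0 \<le> \<alpha>" "0 \<le> \<beta>" and Z: "0 \<in> Z" and R: "1 \<le> R"
    and q: "(3 + \<alpha> + \<beta>) / 2 < q"
  obtains \<mu> :: "('h \<Rightarrow>\<^sub>L 'e::euclidean_space) measure" and K B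
  where "sets \<mu> = sets borel" "prob_space \<mu>" "compact K" "emeasure \<mu> K = 1"
    "\<And>f. f \<in> K \<Longrightarrow> norm f \<le> B"
    "\<And>j z c a d. z \<in> Z \<Longrightarrow> R / 2 ^ Suc j \<le> norm z \<Longrightarrow> norm z < R / 2 ^ j \<Longrightarrow>
      norm (c - z) \<le> R / 2 ^ j / 8 \<Longrightarrow> 0 \<le> d \<Longrightarrow>
      emeasure \<mu> {f. norm (blinfun_apply f c - a) \<le> d}
        \<le> ennreal (2 * (16 * d * real (Suc j) powr q / (R / 2 ^ j)) ^ DIM('e))"
proof -
  obtain C n e where C: "0 < C" and n: "\<And>j. real (n j) \<le> C * real (Suc j) powr (\<alpha> + \<beta>)"
    and e: "\<And>j i. norm (e j i :: 'h) \<le> 1"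
    and probe: "\<And>j z. z \<in> Z \<Longrightarrow> R / 2 ^ Suc j \<le> norm z \<Longrightarrow> norm z < R / 2 ^ j \<Longrightarrow>
      \<exists>i<n j. R / 2 ^ j / 4 \<le> z \<bullet> e j i"
    by (rule homogeneous_probe_vectors[OF hom M ab Z R]) blast
  define \<epsilon> where "\<epsilon> = (q - (3 + \<alpha> + \<beta>) / 2) / 2"
  have \<epsilon>: "0 < \<epsilon>" unfolding \<epsilon>_def using q by simp
  define \<sigma> where "\<sigma> = (\<Sum>j. real (Suc j) powr (- 1 - 2 * \<epsilon>))"
  have sum_\<sigma>: "summable (\<lambda>j. real (Suc j) powr (- 1 - 2 * \<epsilon>))"
    using \<epsilon> by (intro summable_Suc_powr) simp
  have \<sigma>: "0 \<le> \<sigma>" unfolding \<sigma>_def by (intro suminf_nonneg sum_\<sigma>) auto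
  \<comment> \<open>Large enough for the sum of the exceptional probabilities to be at most one half.\<close>
  define c1 where "c1 = 1 + 2 * C * \<sigma>"
  have c1: "1 \<le> c1" unfolding c1_def using C \<sigma> by simp
  define w where "w j = real (Suc j) powr - q" for j
  define T where "T j = c1 * real (Suc j) powr (1 / 2 + \<epsilon> + (\<alpha> + \<beta>) / 2)" for j
  have w: "0 < w j" for j by (simp add: w_def)
  have T: "0 < T j" for j using c1 by (simp add: T_def)
  have wT: "summable (\<lambda>j. w j * T j)"
  proof -
    have "w j * T j = c1 * real (Suc j) powr (- 1 - \<epsilon>)" for j
    proof -
      have exponent: "- q + (1 / 2 + \<epsilon> + (\<alpha> + \<beta>) / 2) = - 1 - \<epsilon>"
        unfolding \<epsilon>_def by (simp add: field_simps)
      have "w j * T j = c1 * real (Suc j) powr (- q + (1 / 2 + \<epsilon> + (\<alpha> + \<beta>) / 2))"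
        unfolding w_def T_def powr_add[of _ "- q"] by (simp only: mult_ac)
      then show ?thesis unfolding exponent .
    qed
    then show ?thesis using \<epsilon> by (simp only:) (intro summable_mult summable_Suc_powr, simp)
  qed
  have nT: "n j / (T j)\<^sup>2 \<le> C / c1\<^sup>2 * real (Suc j) powr (- 1 - 2 * \<epsilon>)" for j
  proof -
    have T2: "(T j)\<^sup>2 = c1\<^sup>2 * real (Suc j) powr (1 + 2 * \<epsilon> + (\<alpha> + \<beta>))"
    proof -
      have exponent: "1 + 2 * \<epsilon> + (\<alpha> + \<beta>) = (1 / 2 + \<epsilon> + (\<alpha> + \<beta>) / 2) + (1 / 2 + \<epsilon> + (\<alpha> + \<beta>) / 2)"
        by (simp add: field_simps)
      show ?thesis
        unfolding T_def power_mult_distrib exponent powr_add[of _ "1 / 2 + \<epsilon> + (\<alpha> + \<beta>) / 2"]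
        by (simp only: power2_eq_square)
    qed
    have "n j / (T j)\<^sup>2 \<le> C * real (Suc j) powr (\<alpha> + \<beta>) / (T j)\<^sup>2"
      by (intro divide_right_mono n) auto
    also have "\<dots> = C / c1\<^sup>2 * (real (Suc j) powr (\<alpha> + \<beta>) / real (Suc j) powr (1 + 2 * \<epsilon> + (\<alpha> + \<beta>)))"
      unfolding T2 by simp
    also have "real (Suc j) powr (\<alpha> + \<beta>) / real (Suc j) powr (1 + 2 * \<epsilon> + (\<alpha> + \<beta>)) =
        real (Suc j) powr (- 1 - 2 * \<epsilon>)"
      unfolding powr_diff[symmetric] by (rule arg_cong[where f = "(powr) _"]) simp
    finally show ?thesis .
  qed
  have nT_sum: "summable (\<lambda>j. n j / (T j)\<^sup>2)"
    using nT by (intro summable_comparison_test'[OF summable_mult[OF sum_\<sigma>, of "C / c1\<^sup>2"]]) auto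
  have nT_le: "(\<Sum>j. n j / (T j)\<^sup>2) \<le> 1 / 2"
  proof -
    have "(\<Sum>j. n j / (T j)\<^sup>2) \<le> (\<Sum>j. C / c1\<^sup>2 * real (Suc j) powr (- 1 - 2 * \<epsilon>))"
      by (intro suminf_le nT nT_sum summable_mult sum_\<sigma>)
    also have "\<dots> = C / c1\<^sup>2 * \<sigma>" unfolding \<sigma>_def by (rule suminf_mult[OF sum_\<sigma>])
    also have "\<dots> \<le> 1 / 2"
    proof -
      have "2 * C * \<sigma> \<le> c1 * 1" by (simp add: c1_def)
      also have "\<dots> \<le> c1 * c1" using c1 by (intro mult_left_mono) auto
      finally show ?thesis using c1 by (simp add: field_simps power2_eq_square)
    qed
    finally show ?thesis .
  qed
  obtain \<mu> :: "('h \<Rightarrow>\<^sub>L 'e) measure" and K B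
    where \<mu>: "sets \<mu> = sets borel" "prob_space \<mu>" "compact K" "emeasure \<mu> K = 1"
    "\<And>f. f \<in> K \<Longrightarrow> norm f \<le> B"
    and small: "\<And>j i c a d. i < n j \<Longrightarrow> 0 < \<bar>c \<bullet> e j i\<bar> \<Longrightarrow> 0 \<le> d \<Longrightarrow>
      emeasure \<mu> {f. norm (blinfun_apply f c - a) \<le> d}
        \<le> ennreal (2 * (2 * d / (w j * \<bar>c \<bullet> e j i\<bar>)) ^ DIM('e))"
    by (rule random_blinfun_exists[of e w T n, where 'e='e]) (use e w T wT nT_sum nT_le in blast)+
  show thesis
  proof (rule that[OF \<mu>])
    fix j z c a and d :: real
    assume z: "z \<in> Z" "R / 2 ^ Suc j \<le> norm z" "norm z < R / 2 ^ j"
      and c: "norm (c - z) \<le> R / 2 ^ j / 8" and d: "0 \<le> d"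
    let ?r = "R / 2 ^ j"
    have r: "0 < ?r" using R by simp
    obtain i where i: "i < n j" "?r / 4 \<le> z \<bullet> e j i" using probe[OF z] by blast
    have "(z - c) \<bullet> e j i \<le> norm (z - c) * norm (e j i)" by (rule norm_cauchy_schwarz)
    also have "\<dots> \<le> ?r / 8 * 1" using c e[of j i] r
      by (intro mult_mono) (auto simp: norm_minus_commute)
    finally have ce: "?r / 8 \<le> c \<bullet> e j i" using i(2) by (simp add: inner_diff_left)
    moreover have "0 < ?r / 8" using r by simp
    ultimately have pos: "0 < \<bar>c \<bullet> e j i\<bar>" by linarith
    have "2 * d / (w j * \<bar>c \<bullet> e j i\<bar>) \<le> 2 * d / (w j * (?r / 8))"
      using ce r d w[of j] pos by (intro divide_left_mono mult_left_mono mult_pos_pos) auto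
    also have "\<dots> = 16 * d * real (Suc j) powr q / ?r"
      by (simp add: w_def powr_minus field_simps)
    finally have "(2 * d / (w j * \<bar>c \<bullet> e j i\<bar>)) ^ DIM('e) \<le> (16 * d * real (Suc j) powr q / ?r) ^ DIM('e)"
      using d w[of j] by (intro power_mono) auto
    then show "emeasure \<mu> {f. norm (blinfun_apply f c - a) \<le> d}
        \<le> ennreal (2 * (16 * d * real (Suc j) powr q / ?r) ^ DIM('e))"
      by (intro order_trans[OF small[OF i(1) pos d]] ennreal_leI mult_left_mono) auto
  qed
qed

section \<open>Operators with a logarithmic lower bound\<close>

text \<open>For \<open>Z = X - X\<close> these are exactly the operators that satisfy the lower
  half of the almost bi-Lipschitz estimate on \<open>X\<close>; the upper half holds for every bounded operator.\<close>

definition log_lower_bounded :: "real \<Rightarrow> 'h::real_normed_vector set \<Rightarrow> ('h \<Rightarrow>\<^sub>L 'e::real_normed_vector) set" where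
  "log_lower_bounded \<gamma> Z =
     {f. \<exists>\<eta>>0. \<forall>z\<in>Z - {0}. \<eta> * (norm z / slog (norm z) powr \<gamma>) \<le> norm (blinfun_apply f z)}"

text \<open>The operators that admit the fixed constant \<open>1 / Suc m\<close> form a closed set, so the
  whole set is a countable union of closed sets.\<close>

lemma log_lower_bounded_borel:
  "(log_lower_bounded \<gamma> Z :: ('h::real_normed_vector \<Rightarrow>\<^sub>L 'e::real_normed_vector) set) \<in> sets borel"
proof -
  let ?S = "log_lower_bounded \<gamma> Z :: ('h \<Rightarrow>\<^sub>L 'e) set"
  let ?D = "\<lambda>m. {f :: 'h \<Rightarrow>\<^sub>L 'e. \<forall>z\<in>Z - {0}. inverse (real (Suc m)) * (norm z / slog (norm z) powr \<gamma>) \<le> norm (blinfun_apply f z)}"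
  have eq: "?S = (\<Union>m. ?D m)"
  proof (intro equalityI subsetI)
    fix f assume "f \<in> ?S"
    then obtain \<eta> where \<eta>: "0 < \<eta>"
      "\<And>z. z \<in> Z - {0} \<Longrightarrow> \<eta> * (norm z / slog (norm z) powr \<gamma>) \<le> norm (blinfun_apply f z)"
      unfolding log_lower_bounded_def by blast
    obtain m where m: "inverse (real (Suc m)) < \<eta>" using reals_Archimedean[OF \<eta>(1)] by auto
    have "f \<in> ?D m"
    proof (intro CollectI ballI)
      fix z assume z: "z \<in> Z - {0}"
      have "inverse (real (Suc m)) * (norm z / slog (norm z) powr \<gamma>) \<le> \<eta> * (norm z / slog (norm z) powr \<gamma>)"
        using m by (intro mult_right_mono) auto
      also have "\<dots> \<le> norm (blinfun_apply f z)" using \<eta>(2) z by auto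
      finally show "inverse (real (Suc m)) * (norm z / slog (norm z) powr \<gamma>) \<le> norm (blinfun_apply f z)" .
    qed
    then show "f \<in> (\<Union>m. ?D m)" by blast
  next
    fix f assume "f \<in> (\<Union>m. ?D m)"
    then obtain m where "f \<in> ?D m" by blast
    then show "f \<in> ?S"
      unfolding log_lower_bounded_def by (intro CollectI exI[of _ "inverse (real (Suc m))"]) auto
  qed
  have "closed (?D m)" for m
    unfolding Collect_ball_eq by (intro closed_INT ballI closed_Collect_le continuous_intros)
  then show ?thesis unfolding eq by (intro sets.countable_UN image_subsetI borel_closed)
qed

text \<open>A union bound over the dyadic shells and, within shell \<open>j\<close>, over a cover of mesh
  \<open>\<rho> j\<close>. Fix \<open>t \<ge> 0\<close> and let \<open>\<delta> j = exp (- t) * (R / 2 ^ j) * (j + 1) powr - \<gamma>\<close> be the value of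
  \<open>norm ((f - v) z)\<close> to be exceeded. All operators involved have norm at most \<open>B'\<close>, so with mesh
  \<open>\<delta> j / B'\<close> a failure at some \<open>z\<close> forces \<open>norm ((f - v) c) \<le> 2 * \<delta> j\<close> at a centre \<open>c\<close>. With \<open>N\<close> the
  dimension of the target, the number of centres times the small-ball probability is at most a constant times
  \<open>exp (- (N - s) * t) * (1 + t) powr \<alpha> * (j + 1) powr (\<gamma> * s + \<alpha> + \<beta> + N * (q - \<gamma>))\<close>. The
  last exponent being below \<open>-1\<close>, the sum over \<open>j\<close> is finite, and it tends to \<open>0\<close> as \<open>t\<close> grows. The
  operators failing for every \<open>t\<close> therefore form a null set, for every translation \<open>v\<close>.\<close>

lemma translate_log_lower_bounded_full:
  fixes \<mu> :: "('h::real_inner \<Rightarrow>\<^sub>L 'e::euclidean_space) measure" and Z :: "'h set"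
    and \<alpha> \<beta> \<gamma> s q M R B :: real
  assumes hom: "almost_Ms_homogeneous \<alpha> \<beta> M s Z" and M: "1 \<le> M" and s: "s < DIM('e)"
    and ab: "0 \<le> \<alpha>" "0 \<le> \<beta>" and Z: "0 \<in> Z" and R: "1 \<le> R" "\<And>z. z \<in> Z \<Longrightarrow> norm z < R"
    and \<gamma>: "0 \<le> \<gamma>" "\<gamma> * s + \<alpha> + \<beta> + DIM('e) * (q - \<gamma>) < - 1"
    and sets_\<mu>: "sets \<mu> = sets borel" and prob: "prob_space \<mu>"
    and K: "compact K" "emeasure \<mu> K = 1" "\<And>f. f \<in> K \<Longrightarrow> norm f \<le> B"
    and small: "\<And>j z c a d. z \<in> Z \<Longrightarrow> R / 2 ^ Suc j \<le> norm z \<Longrightarrow> norm z < R / 2 ^ j \<Longrightarrow>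
      norm (c - z) \<le> R / 2 ^ j / 8 \<Longrightarrow> 0 \<le> d \<Longrightarrow>
      emeasure \<mu> {f. norm (blinfun_apply f c - a) \<le> d}
        \<le> ennreal (2 * (16 * d * real (Suc j) powr q / (R / 2 ^ j)) ^ DIM('e))"
  shows "emeasure \<mu> ((\<lambda>f. f + v) ` log_lower_bounded \<gamma> Z) = 1"
proof -
  interpret prob_space \<mu> by fact
  have space_\<mu>: "space \<mu> = UNIV" using sets_eq_imp_space_eq[OF sets_\<mu>] by simp
  let ?N = "DIM('e)"
  define S where "S = (\<lambda>f. f + v) ` (log_lower_bounded \<gamma> Z :: ('h \<Rightarrow>\<^sub>L 'e) set)"
  have S_iff: "f \<in> S \<longleftrightarrow> f - v \<in> log_lower_bounded \<gamma> Z" for f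
    unfolding S_def by (auto intro!: image_eqI[of f _ "f - v"])
  have S_sets: "S \<in> sets \<mu>"
  proof -
    have "(\<lambda>f. f - v) -` log_lower_bounded \<gamma> Z \<inter> space borel \<in> sets borel"
      by (rule measurable_sets[OF _ log_lower_bounded_borel])
        (intro borel_measurable_continuous_onI continuous_intros)
    moreover have "(\<lambda>f. f - v) -` log_lower_bounded \<gamma> Z \<inter> space borel = S"
      by (auto simp: S_iff)
    ultimately show ?thesis by (simp add: sets_\<mu>)
  qed
  define B' where "B' = 8 + \<bar>B\<bar> + norm v"
  have B': "8 \<le> B'" by (simp add: B'_def)
  define D where "D = ln (R\<^sup>2 + 1) + 1 + \<gamma> + ln B'"
  have D: "ln (R\<^sup>2 + 1) + 1 \<le> D" "1 \<le> D"
    unfolding D_def using \<gamma> B' R by (auto intro!: add_nonneg_nonneg)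
  define p where "p = \<gamma> * s + \<alpha> + \<beta> + ?N * (q - \<gamma>)"
  define c0 where "c0 = M * B' powr s * D powr \<beta> * D powr \<alpha> * (2 * 32 ^ ?N)"
  have c0: "0 \<le> c0" unfolding c0_def using M by (intro mult_nonneg_nonneg) auto
  define \<sigma> where "\<sigma> = (\<Sum>j. real (Suc j) powr p)"
  have sum_\<sigma>: "summable (\<lambda>j. real (Suc j) powr p)"
    using \<gamma>(2) by (intro summable_Suc_powr) (simp add: p_def)
  obtain E where E: "0 < E" "\<And>j x. 0 < x \<Longrightarrow> x \<le> R / 2 ^ j \<Longrightarrow> real (Suc j) \<le> E * slog x"
    by (rule Suc_le_slog_dyadic[OF R(1)]) blast
  have bound: "measure \<mu> (- S) \<le> c0 * \<sigma> * (exp (- (?N - s) * t) * (1 + t) powr \<alpha>)" if t: "0 \<le> t" for t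
  proof -
    define r where "r j = R / 2 ^ j" for j :: nat
    define \<delta> where "\<delta> j = exp (- t) * r j * real (Suc j) powr - \<gamma>" for j
    define \<rho> where "\<rho> j = \<delta> j / B'" for j
    have r: "0 < r j" for j using R by (simp add: r_def)
    have \<delta>: "0 < \<delta> j" for j using r by (simp add: \<delta>_def)
    have \<rho>: "0 < \<rho> j" for j using \<delta>[of j] B' by (simp add: \<rho>_def)
    have \<delta>_le: "\<delta> j \<le> r j" for j
    proof -
      have "real (Suc j) powr - \<gamma> \<le> 1"
        using \<gamma>(1) by (simp add: powr_minus ge_one_powr_ge_zero inverse_le_1_iff)
      then have "exp (- t) * r j * real (Suc j) powr - \<gamma> \<le> 1 * r j * 1"
        using t r[of j] by (intro mult_mono) auto
      then show ?thesis by (simp add: \<delta>_def)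
    qed
    have \<rho>_le: "\<rho> j \<le> r j / 8" for j
      unfolding \<rho>_def using \<delta>_le[of j] \<delta>[of j] B' by (intro frac_le) auto
    have "\<exists>A. A \<subseteq> Z \<and> finite A \<and> ball 0 (r j) \<inter> Z \<subseteq> (\<Union>c\<in>A. ball c (\<rho> j)) \<and>
        real (card A) \<le> M * (r j / \<rho> j) powr s * slog (r j) powr \<beta> * slog (\<rho> j) powr \<alpha>" for j
    proof -
      have "\<rho> j < r j" using \<rho>_le[of j] r[of j] by linarith
      from almost_Ms_homogeneousD[OF hom \<rho> this Z] show ?thesis by metis
    qed
    then obtain A where A: "\<And>j. A j \<subseteq> Z" "\<And>j. finite (A j)"
      "\<And>j. ball 0 (r j) \<inter> Z \<subseteq> (\<Union>c\<in>A j. ball c (\<rho> j))"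
      "\<And>j. real (card (A j)) \<le> M * (r j / \<rho> j) powr s * slog (r j) powr \<beta> * slog (\<rho> j) powr \<alpha>"
      by metis
    \<comment> \<open>Only centres close to the shell matter; for these the small-ball estimate is available.\<close>
    define A' where "A' j = {c \<in> A j. \<exists>z\<in>Z. r (Suc j) \<le> norm z \<and> norm z < r j \<and> norm (c - z) \<le> \<rho> j}" for j
    have A': "finite (A' j)" "card (A' j) \<le> card (A j)" for j
      using A(2)[of j] by (auto simp: A'_def intro!: card_mono)
    define bad where "bad j c = {f :: 'h \<Rightarrow>\<^sub>L 'e. norm (blinfun_apply f c - blinfun_apply v c) \<le> 2 * \<delta> j}" for j c
    have bad_sets: "bad j c \<in> sets \<mu>" for j c
      unfolding bad_def sets_\<mu> by (intro borel_closed closed_Collect_le continuous_intros)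
    have cover: "- S \<subseteq> - K \<union> (\<Union>j. \<Union>c\<in>A' j. bad j c)"
    proof (rule subsetI, rule ccontr)
      fix f assume f: "f \<in> - S" "f \<notin> - K \<union> (\<Union>j. \<Union>c\<in>A' j. bad j c)"
      let ?\<eta> = "exp (- t) * E powr - \<gamma>"
      have "f - v \<in> log_lower_bounded \<gamma> Z"
        unfolding log_lower_bounded_def
      proof (intro CollectI exI[of _ ?\<eta>] conjI ballI)
        show "0 < ?\<eta>" using E(1) by simp
        fix z assume z: "z \<in> Z - {0}"
        obtain j where j: "r (Suc j) \<le> norm z" "norm z < r j"
          using dyadic_scale_exists[of "norm z" R] z R(2)[of z] by (auto simp: r_def)
        obtain c where c: "c \<in> A j" "dist c z < \<rho> j"
          using A(3)[of j] z j by (auto simp: subset_iff)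
        then have "c \<in> A' j" unfolding A'_def using z j by (auto simp: dist_norm intro!: bexI[of _ z])
        then have nc: "2 * \<delta> j < norm (blinfun_apply (f - v) c)"
          using f(2) by (auto simp: bad_def blinfun.diff_left not_le)
        have "norm (f - v) \<le> B'"
          using norm_triangle_ineq4[of f v] K(3)[of f] f(2) by (auto simp: B'_def)
        then have "norm (blinfun_apply (f - v) (c - z)) \<le> B' * \<rho> j"
          using c(2) B' by (intro order_trans[OF norm_blinfun] mult_mono) (auto simp: dist_norm)
        also have "\<dots> = \<delta> j" using B' by (simp add: \<rho>_def)
        finally have "norm (blinfun_apply (f - v) c - blinfun_apply (f - v) z) \<le> \<delta> j"
          by (simp add: blinfun.diff_right)
        with nc have z\<delta>: "\<delta> j \<le> norm (blinfun_apply (f - v) z)"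
          using norm_triangle_sub[of "blinfun_apply (f - v) c" "blinfun_apply (f - v) z"] by linarith
        have zp: "0 < norm z" using z by simp
        have "(E * slog (norm z)) powr - \<gamma> \<le> real (Suc j) powr - \<gamma>"
          using E(2)[of "norm z" j] zp j \<gamma>(1) by (intro powr_mono2') (auto simp: r_def)
        then have "norm z * (E powr - \<gamma> * slog (norm z) powr - \<gamma>) \<le> r j * real (Suc j) powr - \<gamma>"
          using j r[of j] E(1) slog_pos[OF zp] by (intro mult_mono) (auto simp: powr_mult)
        then have "exp (- t) * (norm z * (E powr - \<gamma> * slog (norm z) powr - \<gamma>)) \<le> \<delta> j"
          unfolding \<delta>_def mult.assoc by (intro mult_left_mono) auto
        also note z\<delta>
        finally show "?\<eta> * (norm z / slog (norm z) powr \<gamma>) \<le> norm (blinfun_apply (f - v) z)"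
          by (simp add: powr_minus[of "slog (norm z)"] divide_inverse mult_ac)
      qed
      then show False using f(1) S_iff by simp
    qed
    have card_A: "real (card (A' j)) * (2 * (16 * (2 * \<delta> j) * real (Suc j) powr q / r j) ^ ?N)
        \<le> c0 * (exp (- (?N - s) * t) * (1 + t) powr \<alpha>) * real (Suc j) powr p" for j
    proof -
      have ratio: "r j / \<rho> j = B' * exp t * real (Suc j) powr \<gamma>"
        using r[of j] B' by (simp add: \<rho>_def \<delta>_def exp_minus powr_minus field_simps)
      have s1: "slog (r j) \<le> D * real (Suc j)"
      proof -
        have "slog (r j) \<le> (ln (R\<^sup>2 + 1) + 1) * real (Suc j)"
          using slog_dyadic_le[OF R(1), of 1 j] by (simp add: r_def)
        also have "\<dots> \<le> D * real (Suc j)" using D by (intro mult_right_mono) auto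
        finally show ?thesis .
      qed
      \<comment> \<open>The mesh depends on \<open>t\<close>, which costs the factor \<open>1 + t\<close>; it is harmless against the exponential.\<close>
      have s2: "slog (\<rho> j) \<le> D * real (Suc j) * (1 + t)"
      proof -
        define \<theta> where "\<theta> = exp (- t) * real (Suc j) powr - \<gamma> / B'"
        have \<theta>: "0 < \<theta>" using B' by (simp add: \<theta>_def)
        have eq: "\<rho> j = \<theta> * (R / 2 ^ j)" by (simp add: \<rho>_def \<delta>_def \<theta>_def r_def mult_ac)
        then have "\<theta> * r j \<le> 1 * r j" using \<rho>_le[of j] r[of j] by (simp add: r_def)
        then have "\<theta> \<le> 1" using r[of j] by (simp only: mult_le_cancel_right_pos)
        from slog_dyadic_le[OF R(1) \<theta> this, of j]
        have "slog (\<rho> j) \<le> (ln (R\<^sup>2 + 1) + 1) * real (Suc j) - ln \<theta>" by (simp only: eq)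
        also have "ln \<theta> = - t - \<gamma> * ln (real (Suc j)) - ln B'"
          using B' by (simp add: \<theta>_def ln_div ln_mult ln_powr)
        also have "(ln (R\<^sup>2 + 1) + 1) * real (Suc j) - (- t - \<gamma> * ln (real (Suc j)) - ln B') \<le>
            (ln (R\<^sup>2 + 1) + 1) * real (Suc j) + t * (D * real (Suc j)) + \<gamma> * real (Suc j) + ln B' * real (Suc j)"
        proof -
          have "1 * 1 \<le> D * real (Suc j)" using D by (intro mult_mono) auto
          then have "t * 1 \<le> t * (D * real (Suc j))" using t by (intro mult_left_mono) auto
          moreover have "\<gamma> * ln (real (Suc j)) \<le> \<gamma> * real (Suc j)"
            using \<gamma>(1) ln_bound[of "real (Suc j)"] by (intro mult_left_mono) auto
          moreover have "ln B' * 1 \<le> ln B' * real (Suc j)"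
            using B' by (intro mult_left_mono) auto
          ultimately show ?thesis by simp
        qed
        also have "\<dots> = D * real (Suc j) * (1 + t)" by (simp add: D_def algebra_simps)
        finally show ?thesis .
      qed
      have N_powr: "x ^ ?N = x powr real ?N" if "0 < x" for x :: real using that by (simp add: powr_realpow)
      have "real (card (A' j)) \<le> real (card (A j))" using A'(2)[of j] by simp
      also have "\<dots> \<le> M * (r j / \<rho> j) powr s * slog (r j) powr \<beta> * slog (\<rho> j) powr \<alpha>" by (rule A(4))
      also have "\<dots> \<le> M * (B' * exp t * real (Suc j) powr \<gamma>) powr s * (D * real (Suc j)) powr \<beta> *
          (D * real (Suc j) * (1 + t)) powr \<alpha>"
        unfolding ratio using M s1 s2 ab slog_pos[OF r[of j]] slog_pos[OF \<rho>[of j]]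
        by (intro mult_mono powr_mono2 mult_nonneg_nonneg order_refl) auto
      also have "\<dots> = M * B' powr s * D powr \<beta> * D powr \<alpha> * (exp (t * s) * (1 + t) powr \<alpha>) *
          real (Suc j) powr (\<gamma> * s + \<alpha> + \<beta>)"
        using B' D t by (simp add: powr_mult powr_powr powr_add exp_powr_real mult_ac)
      finally have count: "real (card (A' j)) \<le> M * B' powr s * D powr \<beta> * D powr \<alpha> *
          (exp (t * s) * (1 + t) powr \<alpha>) * real (Suc j) powr (\<gamma> * s + \<alpha> + \<beta>)" .
      have "16 * (2 * \<delta> j) * real (Suc j) powr q / r j = 32 * (exp (- t) * real (Suc j) powr (q - \<gamma>))"
        using r[of j] by (simp add: \<delta>_def powr_diff powr_minus field_simps)
      then have "(16 * (2 * \<delta> j) * real (Suc j) powr q / r j) ^ ?N =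
          32 ^ ?N * (exp (- t * ?N) * real (Suc j) powr (?N * (q - \<gamma>)))"
        by (simp only: power_mult_distrib)
          (simp add: exp_of_nat2_mult[symmetric] powr_power mult.commute)
      then have "real (card (A' j)) * (2 * (16 * (2 * \<delta> j) * real (Suc j) powr q / r j) ^ ?N)
        \<le> M * B' powr s * D powr \<beta> * D powr \<alpha> * (exp (t * s) * (1 + t) powr \<alpha>) *
          real (Suc j) powr (\<gamma> * s + \<alpha> + \<beta>) *
          (2 * (32 ^ ?N * (exp (- t * ?N) * real (Suc j) powr (?N * (q - \<gamma>)))))"
        by (simp only:) (intro mult_right_mono count, simp)
      also have "\<dots> = c0 * ((exp (t * s) * exp (- t * ?N)) * (1 + t) powr \<alpha>) *
          (real (Suc j) powr (\<gamma> * s + \<alpha> + \<beta>) * real (Suc j) powr (?N * (q - \<gamma>)))"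
        by (simp add: c0_def mult_ac)
      also have "exp (t * s) * exp (- t * ?N) = exp (- (?N - s) * t)"
        by (simp add: exp_add[symmetric] algebra_simps)
      also have "real (Suc j) powr (\<gamma> * s + \<alpha> + \<beta>) * real (Suc j) powr (?N * (q - \<gamma>)) = real (Suc j) powr p"
        by (simp add: p_def powr_add)
      finally show ?thesis .
    qed
    have em_bad: "emeasure \<mu> (\<Union>c\<in>A' j. bad j c) \<le>
        ennreal (c0 * (exp (- (?N - s) * t) * (1 + t) powr \<alpha>) * real (Suc j) powr p)" for j
    proof -
      let ?x = "2 * (16 * (2 * \<delta> j) * real (Suc j) powr q / r j) ^ ?N"
      have x: "0 \<le> ?x" using \<delta>[of j] r[of j] by simp
      have "emeasure \<mu> (\<Union>c\<in>A' j. bad j c) \<le> (\<Sum>c\<in>A' j. emeasure \<mu> (bad j c))"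
        using A'(1) bad_sets by (intro emeasure_subadditive_finite) auto
      also have "\<dots> \<le> (\<Sum>c\<in>A' j. ennreal ?x)"
      proof (rule sum_mono)
        fix c assume "c \<in> A' j"
        then obtain z where z: "z \<in> Z" "r (Suc j) \<le> norm z" "norm z < r j" "norm (c - z) \<le> \<rho> j"
          by (auto simp: A'_def)
        then show "emeasure \<mu> (bad j c) \<le> ennreal ?x"
          unfolding bad_def using small[of z j c "2 * \<delta> j"] \<rho>_le[of j] \<delta>[of j] by (simp add: r_def)
      qed
      also have "\<dots> = ennreal (real (card (A' j)) * ?x)"
        using x by (simp add: ennreal_mult' ennreal_of_nat_eq_real_of_nat)
      also have "\<dots> \<le> ennreal (c0 * (exp (- (?N - s) * t) * (1 + t) powr \<alpha>) * real (Suc j) powr p)"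
        by (intro ennreal_leI card_A)
      finally show ?thesis .
    qed
    have null: "emeasure \<mu> (- K) = 0"
    proof -
      have "K \<in> sets \<mu>" using K(1) by (simp add: sets_\<mu> compact_imp_closed)
      then show ?thesis using emeasure_compl[of K \<mu>] K(2) emeasure_space_1
        by (simp add: space_\<mu> Compl_eq_Diff_UNIV)
    qed
    let ?h = "exp (- (?N - s) * t) * (1 + t) powr \<alpha>"
    have "emeasure \<mu> (- S) \<le> emeasure \<mu> (- K \<union> (\<Union>j. \<Union>c\<in>A' j. bad j c))"
      using K(1) A'(1) bad_sets
      by (intro emeasure_mono cover sets.Un sets.countable_UN image_subsetI sets.finite_UN)
        (auto simp: sets_\<mu> compact_imp_closed)
    also have "\<dots> \<le> emeasure \<mu> (- K) + emeasure \<mu> (\<Union>j. \<Union>c\<in>A' j. bad j c)"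
      using K(1) A'(1) bad_sets
      by (intro emeasure_subadditive sets.countable_UN image_subsetI sets.finite_UN)
        (auto simp: sets_\<mu> compact_imp_closed)
    also have "\<dots> \<le> (\<Sum>j. emeasure \<mu> (\<Union>c\<in>A' j. bad j c))"
      unfolding null using A'(1) bad_sets
      by (simp, intro emeasure_subadditive_countably image_subsetI sets.finite_UN) auto
    also have "\<dots> \<le> (\<Sum>j. ennreal (c0 * ?h * real (Suc j) powr p))"
      by (intro suminf_le em_bad) auto
    also have "\<dots> = ennreal (\<Sum>j. c0 * ?h * real (Suc j) powr p)"
      using c0 by (intro suminf_ennreal2 summable_mult sum_\<sigma>) auto
    also have "(\<Sum>j. c0 * ?h * real (Suc j) powr p) = c0 * ?h * \<sigma>"
      unfolding \<sigma>_def by (rule suminf_mult[OF sum_\<sigma>])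
    finally have "emeasure \<mu> (- S) \<le> ennreal (c0 * ?h * \<sigma>)" .
    moreover have "0 \<le> c0 * ?h * \<sigma>"
      unfolding \<sigma>_def using c0 by (intro mult_nonneg_nonneg suminf_nonneg sum_\<sigma>) auto
    ultimately show ?thesis by (simp add: emeasure_eq_measure mult_ac)
  qed
  have "((\<lambda>t. c0 * \<sigma> * (exp (- (?N - s) * t) * (1 + t) powr \<alpha>)) \<longlongrightarrow> c0 * \<sigma> * 0) at_top"
    using s by (intro tendsto_mult tendsto_const exp_decay_beats_powr) simp
  moreover have "\<forall>\<^sub>F t in at_top. measure \<mu> (- S) \<le> c0 * \<sigma> * (exp (- (?N - s) * t) * (1 + t) powr \<alpha>)"
    using eventually_ge_at_top[of 0] by (rule eventually_mono) (rule bound)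
  ultimately have "measure \<mu> (- S) \<le> c0 * \<sigma> * 0"
    by (rule tendsto_lowerbound) simp
  then have "measure \<mu> (space \<mu> - S) = 0"
    by (simp add: space_\<mu> Compl_eq_Diff_UNIV measure_le_0_iff)
  then have "measure \<mu> S = 1" using prob_compl[OF S_sets] by simp
  then show ?thesis unfolding S_def[symmetric] by (simp add: emeasure_eq_measure)
qed

lemma log_lower_bounded_imp_almost_bi_lipschitz:
  assumes "f \<in> log_lower_bounded \<gamma> {x - y | x y. x \<in> X \<and> y \<in> X}"
  shows "inj_on (blinfun_apply f) X" "almost_bi_lipschitz_on \<gamma> X (blinfun_apply f)"
proof -
  obtain \<eta> where \<eta>: "0 < \<eta>"
    and lower: "\<And>z. z \<in> {x - y | x y. x \<in> X \<and> y \<in> X} - {0} \<Longrightarrow>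
      \<eta> * (norm z / slog (norm z) powr \<gamma>) \<le> norm (blinfun_apply f z)"
    using assms unfolding log_lower_bounded_def by blast
  have low: "\<eta> * (norm (x - y) / slog (norm (x - y)) powr \<gamma>) \<le> norm (blinfun_apply f x - blinfun_apply f y)"
    if "x \<in> X" "y \<in> X" "x \<noteq> y" for x y
    using lower[of "x - y"] that by (auto simp: blinfun.diff_right)
  have pos: "0 < norm (x - y) / slog (norm (x - y)) powr \<gamma>" if "x \<noteq> y" for x y :: 'a
    using slog_pos[of "norm (x - y)"] that by simp
  show "inj_on (blinfun_apply f) X"
  proof (rule inj_onI, rule ccontr)
    fix x y assume "x \<in> X" "y \<in> X" "blinfun_apply f x = blinfun_apply f y" "x \<noteq> y"
    then show False using low[of x y] mult_pos_pos[OF \<eta> pos[of x y]] by simp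
  qed
  show "almost_bi_lipschitz_on \<gamma> X (blinfun_apply f)"
    unfolding almost_bi_lipschitz_on_def
  proof (intro exI[of _ "1 / \<eta> + norm f"] conjI ballI impI)
    show L: "0 < 1 / \<eta> + norm f" using \<eta> by (intro add_pos_nonneg) auto
    fix x y assume xy: "x \<in> X" "y \<in> X" "x \<noteq> y"
    have "1 / (1 / \<eta> + norm f) \<le> \<eta>"
      using \<eta> L by (simp add: pos_divide_le_eq distrib_left)
    then have "1 / (1 / \<eta> + norm f) * (norm (x - y) / slog (norm (x - y)) powr \<gamma>) \<le>
        \<eta> * (norm (x - y) / slog (norm (x - y)) powr \<gamma>)"
      using pos[OF xy(3)] by (intro mult_right_mono) auto
    with low[OF xy] show "1 / (1 / \<eta> + norm f) * (norm (x - y) / slog (norm (x - y)) powr \<gamma>) \<le>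
        norm (blinfun_apply f x - blinfun_apply f y)" by simp
    have "norm (blinfun_apply f x - blinfun_apply f y) = norm (blinfun_apply f (x - y))"
      by (simp add: blinfun.diff_right)
    also have "\<dots> \<le> norm f * norm (x - y)" by (rule norm_blinfun)
    also have "\<dots> \<le> (1 / \<eta> + norm f) * norm (x - y)"
      using \<eta> by (intro mult_right_mono) auto
    finally show "norm (blinfun_apply f x - blinfun_apply f y) \<le> (1 / \<eta> + norm f) * norm (x - y)" .
  qed
qed

section \<open>The embedding theorem\<close>

lemma prevalent_UNIV: "prevalent (UNIV :: 'a::real_normed_vector set)"
  unfolding prevalent_def
proof (intro conjI exI[of _ "return borel (0::'a)"] exI[of _ "{0}"] allI)
  show "prob_space (return borel (0::'a))" by (rule prob_space_return) simp
  show "emeasure (return borel 0) ((\<lambda>x::'a. x + v) ` UNIV) = 1" for v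
    by (simp add: surj_plus_right)
qed auto

theorem theorem5p6:
  fixes X :: "'h::{real_inner, complete_space} set"
    and \<alpha> \<beta> \<gamma> s :: real
  assumes "0 \<le> \<alpha>" and "0 \<le> \<beta>"
    and "compact X"
    and "almost_homogeneous \<alpha> \<beta> {x - y | x y. x \<in> X \<and> y \<in> X}"
    and "assouad_dim \<alpha> \<beta> {x - y | x y. x \<in> X \<and> y \<in> X} < ereal s"
    and "s < real CARD('n::finite)"
    and "\<gamma> > (2 + real CARD('n) * (3 + \<alpha> + \<beta>) + 2 * (\<alpha> + \<beta>)) / (2 * (real CARD('n) - s))"
  shows "\<exists>S :: ('h \<Rightarrow>\<^sub>L (real ^ 'n)) set. prevalent S \<and>
           (\<forall>f\<in>S. inj_on (blinfun_apply f) X \<and> almost_bi_lipschitz_on \<gamma> X (blinfun_apply f))"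
proof (cases "X = {}")
  case True
  then show ?thesis
    by (intro exI[of _ UNIV]) (auto simp: prevalent_UNIV almost_bi_lipschitz_on_def intro: exI[of _ 1])
next
  case False
  let ?Z = "{x - y | x y. x \<in> X \<and> y \<in> X}" and ?N = "real CARD('n)"
  \<comment> \<open>An admissible exponent \<open>s0\<close> below \<open>s\<close> is used throughout, since the infimum defining the dimension need not be attained.\<close>
  obtain s0 M where s0: "0 \<le> s0" "s0 < s" and M: "1 \<le> M" and hom: "almost_Ms_homogeneous \<alpha> \<beta> M s0 ?Z"
    using assms(5) unfolding assouad_dim_def by (auto simp: Inf_less_iff)
  have zero: "0 \<in> ?Z" using False by force
  obtain b where b: "\<And>x. x \<in> X \<Longrightarrow> norm x \<le> b"
    using compact_imp_bounded[OF assms(3)] by (auto simp: bounded_iff)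
  define R where "R = 1 + 2 * \<bar>b\<bar>"
  have R: "1 \<le> R" by (simp add: R_def)
  have ZR: "norm z < R" if z: "z \<in> ?Z" for z
  proof -
    obtain x y where xy: "z = x - y" "x \<in> X" "y \<in> X" using z by auto
    have "norm z \<le> norm x + norm y" unfolding xy(1) by (rule norm_triangle_ineq4)
    then show ?thesis using b[OF xy(2)] b[OF xy(3)] by (simp add: R_def)
  qed
  have N: "0 < ?N" by simp
  have "2 + ?N * (3 + \<alpha> + \<beta>) + 2 * (\<alpha> + \<beta>) < \<gamma> * (2 * (?N - s))"
    using assms(6,7) by (simp add: pos_divide_less_eq)
  moreover have \<gamma>: "0 \<le> \<gamma>"
  proof -
    have "0 \<le> (2 + ?N * (3 + \<alpha> + \<beta>) + 2 * (\<alpha> + \<beta>)) / (2 * (?N - s))"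
      using assms(1,2,6) by (intro divide_nonneg_nonneg add_nonneg_nonneg mult_nonneg_nonneg) auto
    then show ?thesis using assms(7) by linarith
  qed
  moreover have "\<gamma> * (2 * (?N - s)) \<le> \<gamma> * (2 * (?N - s0))"
    using \<gamma> s0 by (intro mult_left_mono) auto
  ultimately have "(3 + \<alpha> + \<beta>) / 2 * ?N < \<gamma> * (?N - s0) - (\<alpha> + \<beta>) - 1"
    by (simp add: field_simps)
  then have "(3 + \<alpha> + \<beta>) / 2 < (\<gamma> * (?N - s0) - (\<alpha> + \<beta>) - 1) / ?N"
    using N by (simp only: pos_less_divide_eq)
  \<comment> \<open>The hypothesis on \<open>\<gamma>\<close> ensures that the range of admissible decay rates \<open>q\<close> is nonempty.\<close>
  then obtain q where q: "(3 + \<alpha> + \<beta>) / 2 < q" "q < (\<gamma> * (?N - s0) - (\<alpha> + \<beta>) - 1) / ?N"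
    using dense by blast
  have "q * ?N < \<gamma> * (?N - s0) - (\<alpha> + \<beta>) - 1"
    using q(2) N by (simp only: pos_less_divide_eq)
  then have exponent: "\<gamma> * s0 + \<alpha> + \<beta> + real DIM(real ^ 'n) * (q - \<gamma>) < - 1"
    by (simp add: algebra_simps)
  obtain \<mu> :: "('h \<Rightarrow>\<^sub>L (real ^ 'n)) measure" and K B where \<mu>: "sets \<mu> = sets borel" "prob_space \<mu>"
    and K: "compact K" "emeasure \<mu> K = 1" "\<And>f. f \<in> K \<Longrightarrow> norm f \<le> B"
    and small: "\<And>j z c a d. z \<in> ?Z \<Longrightarrow> R / 2 ^ Suc j \<le> norm z \<Longrightarrow> norm z < R / 2 ^ j \<Longrightarrow>
      norm (c - z) \<le> R / 2 ^ j / 8 \<Longrightarrow> 0 \<le> d \<Longrightarrow>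
      emeasure \<mu> {f. norm (blinfun_apply f c - a) \<le> d}
        \<le> ennreal (2 * (16 * d * real (Suc j) powr q / (R / 2 ^ j)) ^ DIM(real ^ 'n))"
    by (rule random_blinfun_small_ball[OF hom M assms(1,2) zero R q(1), where 'e="real ^ 'n"]) blast
  let ?S = "log_lower_bounded \<gamma> ?Z :: ('h \<Rightarrow>\<^sub>L (real ^ 'n)) set"
  have "s0 < real DIM(real ^ 'n)" using s0(2) assms(6) by simp
  then have "emeasure \<mu> ((\<lambda>f. f + v) ` ?S) = 1" for v
    by (rule translate_log_lower_bounded_full[OF hom M _ assms(1,2) zero R ZR \<gamma> exponent \<mu> K small])
  then have "prevalent ?S"
    unfolding prevalent_def using \<mu> K log_lower_bounded_borel by blast
  then show ?thesis using log_lower_bounded_imp_almost_bi_lipschitz by blast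
qed

end
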